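(* Let $\gamma>0$, and let $(\mathcal A,\nabla,\mathbf 1)$ be a differential structure (with normalized faithful trace $\tau$, $\tau[\mathbf 1]=1$, and $\sigma=\mathbf 1$) whose associated generator is the generator of the depolarizing channel, $$\mathscr LA=\gamma\big(\tau[A]\mathbf 1-A\big)\qquad(A\in\mathcal A).$$ Then the differential structure has Ricci curvature bounded from below by $\gamma/2$: $\mathrm{Ric}(\mathcal A,\nabla,\mathbf 1)\ge\frac\gamma2$.
   Context: Differential structure $(\mathcal A,\nabla,\sigma)$: $\mathcal A$ is a finite-dimensional von Neumann algebra with faithful tracial positive linear functional $\tau$, together with (1) a finite index set $\mathcal J$ and, for each $j\in\mathcal J$, a finite-dimensional von Neumann algebra $\mathcal B_j$ with faithful tracial positive linear functional $\tau_j$; (2) for each $j$, unital $*$-homomorphisms $\ell_j,r_j:\mathcal A\to\mathcal B_j$ with $\tau_j(\ell_j(A))=\tau_j(r_j(A))=\tau(A)$ for all $A\in\mathcal A$, and a non-zero $V_j\in\mathcal B_j$; (3) for each $j$ there is a unique $j^*\in\mathcal J$ with $V_{j^*}=V_j^*$, and $\mathcal B_{j^*}=\mathcal B_j$, $\tau_{j^*}=\tau_j$; moreover $\tau_j[V_j^*\ell_j(A_1)V_jr_j(A_2)]=\tau_j[V_j^*r_{j^*}(A_1)V_j\ell_{j^*}(A_2)]$ for all $A_1,A_2\in\mathcal A$; (4) an invertible density matrix $\sigma\in\mathcal A$ and numbers $\omega_j\in\mathbb R$ with $\ell_j(\sigma)V_jr_j(\sigma)^{-1}=e^{-\omega_j}V_j$.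 Set $\partial_jA:=V_jr_j(A)-\ell_j(A)V_j\in\mathcal B_j$, $\nabla A:=(\partial_jA)_{j\in\mathcal J}$. The associated generator $\mathscr L$ is defined by $\sum_{j}\tau_j[(\partial_jA_1)^*\ell_j(\sigma^{1/2})(\partial_jA_2)r_j(\sigma^{1/2})]=-\tau[A_1^*\sigma^{1/2}(\mathscr LA_2)\sigma^{1/2}]$ for all $A_1,A_2\in\mathcal A$; $\mathscr P_t=e^{t\mathscr L}$; $\dagger$ denotes adjoints with respect to $\tau[A^*B]$ on $\mathcal A$ and $\tau_j[A^*B]$ on $\mathcal B_j$. Ergodicity means $\ker\mathscr L=\mathrm{lin}\{\mathbf 1\}$ (it holds here). $\mathfrak P$ (resp. $\mathfrak P_+$): positive semidefinite (resp. positive definite) $\rho\in\mathcal A$ with $\tau[\rho]=1$. $\mathcal A_0:=\{A\in\mathcal A: A=A^*,\ \tau[A]=0\}$. Put $\theta_j(r,s):=\Lambda(e^{\omega_j/2}r,e^{-\omega_j/2}s)$ with $\Lambda(r,s)=\frac{r-s}{\log r-\log s}$, $\Lambda(r,r)=r$, extended continuously to $[0,\infty)^2$. For $\rho=\sum_k\lambda_kE_k$ (spectral decomposition), $\widehat\rho_j:=\sum_{k,m}\theta_j(\lambda_k,\lambda_m)\ell_j(E_k)\otimes r_j(E_m)$, $(A\otimes B)\#C:=ACB$, and $\mathscr K_\rho A:=\sum_j\partial_j^\dagger(\widehat\rho_j\#\partial_jA)$. For $\rho\in\mathfrak P_+$, $\mathscr K_\rho$ is a bijection of $\mathcal A_0$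 and defines the Riemannian metric $g_\rho(x,y)=\tau[(\mathscr K_\rho^{-1}x)y]$ on $\mathfrak P_+$. $\mathcal W$ is its Riemannian distance, $\mathcal W(\rho_0,\rho_1)^2=\inf\int_0^1\tau[A_t\mathscr K_{\rho_t}A_t]\,dt$ over smooth curves $(\rho_t)$ in $\mathfrak P_+$ from $\rho_0$ to $\rho_1$ and $(A_t)$ in $\mathcal A_0$ with $\partial_t\rho_t=\mathscr K_{\rho_t}A_t$; $\mathcal W$ extends continuously to a metric on $\mathfrak P$. $\mathrm{Ent}_\sigma(\rho)=\tau[\rho(\log\rho-\log\sigma)]$. $\mathrm{Ric}(\mathcal A,\nabla,\sigma)\ge\lambda$ means that the following equivalent conditions hold: (i) $\mathrm{Ent}_\sigma$ is geodesically $\lambda$-convex on $(\mathfrak P,\mathcal W)$, i.e. any two points of $\mathfrak P$ are joined by a constant speed geodesic $(\gamma_t)_{t\in[0,1]}$ with $\mathrm{Ent}_\sigma(\gamma_t)\le(1-t)\mathrm{Ent}_\sigma(\gamma_0)+t\,\mathrm{Ent}_\sigma(\gamma_1)-\frac\lambda2t(1-t)\mathcal W(\gamma_0,\gamma_1)^2$; (ii) for all $\rho\in\mathfrak P_+$, $A\in\mathcal A_0$: $\mathrm{Hess}_{\mathscr K}\mathrm{Ent}_\sigma(\rho)[A,A]\ge\lambda\,\tau[A\mathscr K_\rho A]$, where $\mathrm{Hess}_{\mathscr K}\mathrm{Ent}_\sigma(\rho)[A,A]=\frac{d^2}{ds^2}\big|_{s=0}\mathrm{Ent}_\sigma(\rho_s)$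 along the Riemannian geodesic in $\mathfrak P_+$ with $\rho_0=\rho$, $\dot\rho_0=\mathscr K_\rho A$. *)

theory Defs
  imports "HOL-Analysis.Analysis"
begin

section \<open>Finite-dimensional von Neumann algebras\<close>

type_synonym 'n cmat = "complex ^ 'n ^ 'n"

definition cscale :: "complex \<Rightarrow> 'n::finite cmat \<Rightarrow> 'n cmat"  (infixr "*\<^sub>C" 75) where
  "c *\<^sub>C X = (\<chi> i j. c * X $ i $ j)"

definition adj :: "'n::finite cmat \<Rightarrow> 'n cmat"  ("_\<^sup>\<star>" [1000] 999) where
  "X\<^sup>\<star> = (\<chi> i j. cnj (X $ j $ i))"

text \<open>
  A finite-dimensional von Neumann algebra is a unital \<open>*\<close>-subalgebra of the operators on a
  finite-dimensional Hilbert space; being weakly closed is automatic.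
\<close>

definition vN_algebra :: "'n::finite cmat set \<Rightarrow> bool" where
  "vN_algebra M \<longleftrightarrow> mat 1 \<in> M \<and>
     (\<forall>X\<in>M. \<forall>Y\<in>M. X + Y \<in> M \<and> X ** Y \<in> M) \<and>
     (\<forall>c. \<forall>X\<in>M. c *\<^sub>C X \<in> M) \<and> (\<forall>X\<in>M. X\<^sup>\<star> \<in> M)"

definition faithful_trace :: "'n::finite cmat set \<Rightarrow> ('n cmat \<Rightarrow> complex) \<Rightarrow> bool" where
  "faithful_trace M t \<longleftrightarrow>
     (\<forall>X\<in>M. \<forall>Y\<in>M. t (X + Y) = t X + t Y) \<and>
     (\<forall>c. \<forall>X\<in>M. t (c *\<^sub>C X) = c * t X) \<and>
     (\<forall>X\<in>M. \<forall>Y\<in>M. t (X ** Y) = t (Y ** X)) \<and>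
     (\<forall>X\<in>M. Im (t (X\<^sup>\<star> ** X)) = 0 \<and> 0 \<le> Re (t (X\<^sup>\<star> ** X))) \<and>
     (\<forall>X\<in>M. t (X\<^sup>\<star> ** X) = 0 \<longrightarrow> X = 0)"

definition unital_star_hom ::
    "'n::finite cmat set \<Rightarrow> 'm::finite cmat set \<Rightarrow> ('n cmat \<Rightarrow> 'm cmat) \<Rightarrow> bool" where
  "unital_star_hom M N h \<longleftrightarrow>
     (\<forall>X\<in>M. h X \<in> N) \<and> h (mat 1) = mat 1 \<and>
     (\<forall>X\<in>M. \<forall>Y\<in>M. h (X + Y) = h X + h Y \<and> h (X ** Y) = h X ** h Y) \<and>
     (\<forall>c. \<forall>X\<in>M. h (c *\<^sub>C X) = c *\<^sub>C h X) \<and> (\<forall>X\<in>M. h (X\<^sup>\<star>) = (h X)\<^sup>\<star>)"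

text \<open>
  The inner product of \<^typ>\<open>complex ^ 'n\<close> is the real part of the Hermitian one, and
  \<open>\<langle>v, X v\<rangle>\<close> is real for self-adjoint \<open>X\<close>.
\<close>

definition pos_semidef :: "'n::finite cmat \<Rightarrow> bool" where
  "pos_semidef X \<longleftrightarrow> X\<^sup>\<star> = X \<and> (\<forall>v. 0 \<le> v \<bullet> (X *v v))"

definition pos_def :: "'n::finite cmat \<Rightarrow> bool" where
  "pos_def X \<longleftrightarrow> X\<^sup>\<star> = X \<and> (\<forall>v. v \<noteq> 0 \<longrightarrow> 0 < v \<bullet> (X *v v))"


section \<open>Functional calculus of self-adjoint matrices\<close>

definition eigenspace :: "'n::finite cmat \<Rightarrow> real \<Rightarrow> (complex ^ 'n) set" where
  "eigenspace X \<mu> = {v. X *v v = complex_of_real \<mu> *s v}"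

definition spec :: "'n::finite cmat \<Rightarrow> real set" where
  "spec X = {\<mu>. eigenspace X \<mu> \<noteq> {0}}"

text \<open>The spectral projection is the orthogonal projection onto the eigenspace.\<close>

definition sproj :: "'n::finite cmat \<Rightarrow> real \<Rightarrow> 'n cmat" where
  "sproj X \<mu> = (THE P. P ** P = P \<and> P\<^sup>\<star> = P \<and> range ((*v) P) = eigenspace X \<mu>)"

definition fun_calc :: "(real \<Rightarrow> real) \<Rightarrow> 'n::finite cmat \<Rightarrow> 'n cmat" where
  "fun_calc f X = (\<Sum>\<mu>\<in>spec X. f \<mu> *\<^sub>R sproj X \<mu>)"


section \<open>Differential structures\<close>

text \<open>
  All the algebras \<open>B\<^sub>j\<close> act on one Hilbert space \<open>\<complex>\<^sup>m\<close>. This loses no generality, since there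
  are finitely many of them and each can be amplified (\<open>X \<mapsto> X \<otimes> 1\<close>) to a common dimension.
\<close>

record ('n, 'm, 'j) diff_data =
  Alg :: "'n cmat set"
  tr :: "'n cmat \<Rightarrow> complex"
  Idx :: "'j set"
  BAlg :: "'j \<Rightarrow> 'm cmat set"
  trB :: "'j \<Rightarrow> 'm cmat \<Rightarrow> complex"
  lhom :: "'j \<Rightarrow> 'n cmat \<Rightarrow> 'm cmat"
  rhom :: "'j \<Rightarrow> 'n cmat \<Rightarrow> 'm cmat"
  Vel :: "'j \<Rightarrow> 'm cmat"
  sig :: "'n cmat"
  freq :: "'j \<Rightarrow> real"

text \<open>
  \<open>adjoint_index S j k\<close> says that \<open>k\<close> qualifies as \<open>j\<^sup>*\<close>. Elements of different algebras are
  never identified, so \<open>V\<^sub>k = V\<^sub>j\<^sup>*\<close> is only meaningful together with the equality of the tracial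
  algebras in which the two sides live.
\<close>

definition adjoint_index :: "('n::finite, 'm::finite, 'j) diff_data \<Rightarrow> 'j \<Rightarrow> 'j \<Rightarrow> bool" where
  "adjoint_index S j k \<longleftrightarrow>
     Vel S k = (Vel S j)\<^sup>\<star> \<and> BAlg S k = BAlg S j \<and> (\<forall>X\<in>BAlg S j. trB S k X = trB S j X)"

definition differential_structure :: "('n::finite, 'm::finite, 'j) diff_data \<Rightarrow> bool" where
  "differential_structure S \<longleftrightarrow>
     vN_algebra (Alg S) \<and> faithful_trace (Alg S) (tr S) \<and> finite (Idx S) \<and>
     (\<forall>j\<in>Idx S.
        vN_algebra (BAlg S j) \<and> faithful_trace (BAlg S j) (trB S j) \<and>
        unital_star_hom (Alg S) (BAlg S j) (lhom S j) \<and>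
        unital_star_hom (Alg S) (BAlg S j) (rhom S j) \<and>
        (\<forall>A\<in>Alg S. trB S j (lhom S j A) = tr S A \<and> trB S j (rhom S j A) = tr S A) \<and>
        Vel S j \<in> BAlg S j \<and> Vel S j \<noteq> 0) \<and>
     (\<forall>j\<in>Idx S. \<exists>!k. k \<in> Idx S \<and> adjoint_index S j k) \<and>
     (\<forall>j\<in>Idx S. \<forall>k\<in>Idx S. adjoint_index S j k \<longrightarrow>
        (\<forall>A\<^sub>1\<in>Alg S. \<forall>A\<^sub>2\<in>Alg S.
           trB S j ((Vel S j)\<^sup>\<star> ** lhom S j A\<^sub>1 ** Vel S j ** rhom S j A\<^sub>2) =
           trB S j ((Vel S j)\<^sup>\<star> ** rhom S k A\<^sub>1 ** Vel S j ** lhom S k A\<^sub>2))) \<and>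
     sig S \<in> Alg S \<and> pos_semidef (sig S) \<and> tr S (sig S) = 1 \<and> invertible (sig S) \<and>
     (\<forall>j\<in>Idx S. lhom S j (sig S) ** Vel S j ** matrix_inv (rhom S j (sig S)) =
        exp (- freq S j) *\<^sub>R Vel S j)"

definition pd :: "('n::finite, 'm::finite, 'j) diff_data \<Rightarrow> 'j \<Rightarrow> 'n cmat \<Rightarrow> 'm cmat" where
  "pd S j A = Vel S j ** rhom S j A - lhom S j A ** Vel S j"

definition pd_dagger :: "('n::finite, 'm::finite, 'j) diff_data \<Rightarrow> 'j \<Rightarrow> 'm cmat \<Rightarrow> 'n cmat" where
  "pd_dagger S j X =
     (THE Y. Y \<in> Alg S \<and> (\<forall>A\<in>Alg S. tr S (A\<^sup>\<star> ** Y) = trB S j ((pd S j A)\<^sup>\<star> ** X)))"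

definition is_generator ::
    "('n::finite, 'm::finite, 'j) diff_data \<Rightarrow> ('n cmat \<Rightarrow> 'n cmat) \<Rightarrow> bool" where
  "is_generator S L \<longleftrightarrow>
     (\<forall>A\<in>Alg S. L A \<in> Alg S) \<and>
     (\<forall>A\<^sub>1\<in>Alg S. \<forall>A\<^sub>2\<in>Alg S.
        (\<Sum>j\<in>Idx S. trB S j ((pd S j A\<^sub>1)\<^sup>\<star> ** lhom S j (fun_calc sqrt (sig S)) **
                              pd S j A\<^sub>2 ** rhom S j (fun_calc sqrt (sig S)))) =
        - tr S (A\<^sub>1\<^sup>\<star> ** fun_calc sqrt (sig S) ** L A\<^sub>2 ** fun_calc sqrt (sig S)))"


section \<open>The Riemannian metric\<close>

definition states_pos :: "('n::finite, 'm::finite, 'j) diff_data \<Rightarrow> 'n cmat set" where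
  "states_pos S = {\<rho> \<in> Alg S. pos_def \<rho> \<and> tr S \<rho> = 1}"

definition tangent :: "('n::finite, 'm::finite, 'j) diff_data \<Rightarrow> 'n cmat set" where
  "tangent S = {A \<in> Alg S. A\<^sup>\<star> = A \<and> tr S A = 0}"

definition log_mean :: "real \<Rightarrow> real \<Rightarrow> real" where
  "log_mean r s =
     (if r = s then r else if r = 0 \<or> s = 0 then 0 else (r - s) / (ln r - ln s))"

definition theta :: "('n::finite, 'm::finite, 'j) diff_data \<Rightarrow> 'j \<Rightarrow> real \<Rightarrow> real \<Rightarrow> real" where
  "theta S j r s = log_mean (exp (freq S j / 2) * r) (exp (- freq S j / 2) * s)"

text \<open>\<open>rho_hat S j \<rho> X\<close> is the contraction of the tensor \<open>\<rho>\<close>-hat of index \<open>j\<close> with \<open>X\<close>.\<close>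

definition rho_hat ::
    "('n::finite, 'm::finite, 'j) diff_data \<Rightarrow> 'j \<Rightarrow> 'n cmat \<Rightarrow> 'm cmat \<Rightarrow> 'm cmat" where
  "rho_hat S j \<rho> X =
     (\<Sum>\<mu>\<in>spec \<rho>. \<Sum>\<nu>\<in>spec \<rho>.
        theta S j \<mu> \<nu> *\<^sub>R (lhom S j (sproj \<rho> \<mu>) ** X ** rhom S j (sproj \<rho> \<nu>)))"

definition Kop :: "('n::finite, 'm::finite, 'j) diff_data \<Rightarrow> 'n cmat \<Rightarrow> 'n cmat \<Rightarrow> 'n cmat" where
  "Kop S \<rho> A = (\<Sum>j\<in>Idx S. pd_dagger S j (rho_hat S j \<rho> (pd S j A)))"

text \<open>The trace below is real for self-adjoint arguments, so that \<open>Re\<close> is a mere coercion.\<close>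

definition metric_g ::
    "('n::finite, 'm::finite, 'j) diff_data \<Rightarrow> 'n cmat \<Rightarrow> 'n cmat \<Rightarrow> 'n cmat \<Rightarrow> real" where
  "metric_g S \<rho> x y = Re (tr S (inv_into (tangent S) (Kop S \<rho>) x ** y))"

text \<open>
  The states of full rank form a relatively open subset of an affine space with direction space
  \<open>tangent S\<close>, so that points and tangent vectors can be handled in this global affine chart.
  For a constant field \<open>x\<close>, the Koszul formula reads
  \<open>g(D\<^sub>s c', x) = d/ds g(c', x) - 1/2 (\<partial>\<^sub>x g)(c', c')\<close>,
  where \<open>D\<^sub>s\<close> is the Levi-Civita covariant derivative along \<open>c\<close>. The definition states that the
  right-hand side vanishes for all \<open>x\<close>, which is the geodesic equation \<open>D\<^sub>s c' = 0\<close>.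
\<close>

definition riem_geodesic ::
    "('n::finite, 'm::finite, 'j) diff_data \<Rightarrow> real set \<Rightarrow> (real \<Rightarrow> 'n cmat) \<Rightarrow>
      (real \<Rightarrow> 'n cmat) \<Rightarrow> bool" where
  "riem_geodesic S I c c' \<longleftrightarrow>
     (\<forall>s\<in>I. c s \<in> states_pos S \<and> (c has_vector_derivative c' s) (at s) \<and>
        c' differentiable (at s) \<and>
        (\<forall>x\<in>tangent S. \<exists>d.
           ((\<lambda>t. metric_g S (c s + t *\<^sub>R x) (c' s) (c' s)) has_real_derivative d) (at 0) \<and>
           ((\<lambda>u. metric_g S (c u) (c' u) x) has_real_derivative d / 2) (at s)))"


section \<open>Entropy and Ricci curvature\<close>

definition Ent :: "('n::finite, 'm::finite, 'j) diff_data \<Rightarrow> 'n cmat \<Rightarrow> real" where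
  "Ent S \<rho> = Re (tr S (\<rho> ** (fun_calc ln \<rho> - fun_calc ln (sig S))))"

definition has_second_derivative_at :: "(real \<Rightarrow> real) \<Rightarrow> real \<Rightarrow> real \<Rightarrow> bool" where
  "has_second_derivative_at f h s \<longleftrightarrow>
     (\<exists>f'. (\<forall>\<^sub>F u in nhds s. (f has_real_derivative f' u) (at u)) \<and>
           (f' has_real_derivative h) (at s))"

text \<open>
  The lower Ricci bound, as a lower bound on the Hessian of the entropy. The Hessian at \<open>\<rho>\<close> in
  direction \<open>Kop S \<rho> A\<close> is the number \<open>h\<close> below; the geodesic \<open>c\<close> with the prescribed initial
  data exists and is unique near \<open>0\<close>, because the metric is smooth.
\<close>

definition Ric_ge :: "('n::finite, 'm::finite, 'j) diff_data \<Rightarrow> real \<Rightarrow> bool" where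
  "Ric_ge S \<kappa> \<longleftrightarrow>
     (\<forall>\<rho>\<in>states_pos S. \<forall>A\<in>tangent S. \<forall>\<epsilon>>0. \<forall>c c'.
        riem_geodesic S {-\<epsilon><..<\<epsilon>} c c' \<and> c 0 = \<rho> \<and> c' 0 = Kop S \<rho> A \<longrightarrow>
        (\<exists>h. has_second_derivative_at (\<lambda>s. Ent S (c s)) h 0 \<and>
             \<kappa> * Re (tr S (A ** Kop S \<rho> A)) \<le> h))"

end

theory Submission
  imports Defs
begin

text \<open>
  Since \<open>\<sigma> = 1\<close>, all frequencies vanish, and the logarithmic mean turns the entropy into a potential
  for the flow: \<open>K\<^sub>\<rho> (log \<rho>) = \<gamma> (\<rho> - 1)\<close>. Hence along a geodesic
  \<open>(Ent \<circ> c)' = \<tau>[c' log c] = \<gamma> g\<^sub>c(c', c - 1)\<close>, and the geodesic equation gives the second derivative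
  \<open>\<gamma> (g(c', c') + 1/2 \<partial>\<^sub>x g(c', c'))\<close> with \<open>x = c - 1\<close>. Moving \<open>\<rho>\<close> to \<open>(1 + t) \<rho> - t 1\<close> increases \<open>K\<close> by
  at most the factor \<open>1 + t\<close>, because \<open>\<Lambda>\<close> is homogeneous of degree one and monotone; by duality
  \<open>\<partial>\<^sub>x g(c', c') \<ge> - g(c', c')\<close>, so the second derivative is at least \<open>\<gamma>/2 g(c', c')\<close>.
\<close>

section \<open>Complex matrices\<close>

text \<open>The proof never establishes smoothness of the functional calculus or of the metric; both
  are handled through finite spectral sums. Three devices replace it. The entropy is differentiated
  by freezing Z = log c(s): the difference between tau[c log c] and the linear function tau[c Z] is
  a relative entropy, hence quadratically small. Derivatives of the metric are taken only where the
  geodesic equation itself asserts them, namely for constant fields x, so the moving field c - 1 is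
  expanded in a fixed basis. Since the derivative of g in direction x is then known to exist,
  right-sided difference quotients determine it, and only the states with t > 0 have to be compared
  with \<rho>. The direction \<rho> - 1 is opposite to the flow, as L \<rho> = \<gamma> (1 - \<rho>)
  for a state \<rho>. Moving along it changes the eigenvalues of \<rho> but not its spectral
  projections, so the comparison of operators reduces to a scalar inequality for each pair of
  eigenvalues.\<close>

lemma adj_adj [simp]: "(X\<^sup>\<star>)\<^sup>\<star> = X"
  by (simp add: adj_def vec_eq_iff)

lemma adj_add: "(X + Y)\<^sup>\<star> = X\<^sup>\<star> + Y\<^sup>\<star>"
  by (simp add: adj_def vec_eq_iff)

lemma adj_diff: "(X - Y)\<^sup>\<star> = X\<^sup>\<star> - Y\<^sup>\<star>"
  by (simp add: adj_def vec_eq_iff)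

lemma adj_scaleR: "(r *\<^sub>R X)\<^sup>\<star> = r *\<^sub>R X\<^sup>\<star>"
  by (simp add: adj_def vec_eq_iff)

lemma adj_0 [simp]: "0\<^sup>\<star> = 0"
  by (simp add: adj_def vec_eq_iff)

lemma adj_mat_1 [simp]: "(mat 1)\<^sup>\<star> = mat 1"
  by (simp add: adj_def vec_eq_iff mat_def)

lemma adj_mult: "(X ** Y)\<^sup>\<star> = Y\<^sup>\<star> ** X\<^sup>\<star>"
  by (simp add: adj_def vec_eq_iff matrix_matrix_mult_def mult.commute)

lemma adj_sum: "(\<Sum>i\<in>I. f i)\<^sup>\<star> = (\<Sum>i\<in>I. (f i)\<^sup>\<star>)"
  by (induction I rule: infinite_finite_induct) (auto simp: adj_add)

text \<open>Algebras and traces are specified with complex scalars, while spans, derivatives and the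
  functional calculus use real ones; this is the bridge.\<close>

lemma scaleR_eq_cscale: "r *\<^sub>R X = complex_of_real r *\<^sub>C X"
  by (simp add: cscale_def vec_eq_iff scaleR_conv_of_real[where 'a = complex])

lemma cmat_mult_distribs:
  fixes X :: "'n::finite cmat"
  shows "X ** (Y + Z) = X ** Y + X ** Z" "(Y + Z) ** X = Y ** X + Z ** X"
    "X ** (Y - Z) = X ** Y - X ** Z" "(Y - Z) ** X = Y ** X - Z ** X"
  by (simp_all add: vec_eq_iff matrix_matrix_mult_def algebra_simps sum.distrib sum_subtractf)

lemma cmat_mult_scaleR:
  fixes X :: "'n::finite cmat"
  shows "X ** (r *\<^sub>R Y) = r *\<^sub>R (X ** Y)" "(r *\<^sub>R X) ** Y = r *\<^sub>R (X ** Y)"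
  by (simp_all add: vec_eq_iff matrix_matrix_mult_def scaleR_sum_right)

lemma cmat_mult_cscale:
  fixes X :: "'n::finite cmat"
  shows "X ** (c *\<^sub>C Y) = c *\<^sub>C (X ** Y)" "(c *\<^sub>C X) ** Y = c *\<^sub>C (X ** Y)"
  by (simp_all add: vec_eq_iff matrix_matrix_mult_def cscale_def sum_distrib_left algebra_simps)

lemma cmat_mult_0 [simp]:
  fixes X :: "'n::finite cmat"
  shows "X ** 0 = 0" "0 ** X = 0"
  by (simp_all add: vec_eq_iff matrix_matrix_mult_def)

lemma cmat_mult_sum:
  fixes X :: "'n::finite cmat"
  shows "X ** (\<Sum>i\<in>I. f i) = (\<Sum>i\<in>I. X ** f i)" "(\<Sum>i\<in>I. f i) ** X = (\<Sum>i\<in>I. f i ** X)"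
  by (induction I rule: infinite_finite_induct) (auto simp: cmat_mult_distribs)

lemma sum_mult_vec:
  fixes f :: "'i \<Rightarrow> 'n::finite cmat"
  shows "(\<Sum>i\<in>I. f i) *v v = (\<Sum>i\<in>I. f i *v v)"
  by (induction I rule: infinite_finite_induct) (auto simp: matrix_vector_mult_add_rdistrib)

lemma scaleR_mult_vec:
  fixes X :: "'n::finite cmat"
  shows "(r *\<^sub>R X) *v v = r *\<^sub>R (X *v v)"
  by (simp add: vec_eq_iff matrix_vector_mult_def scaleR_sum_right)

lemma mult_vec_scaleR:
  fixes X :: "'n::finite cmat"
  shows "X *v (r *\<^sub>R v) = r *\<^sub>R (X *v v)"
  by (simp add: vec_eq_iff matrix_vector_mult_def scaleR_sum_right)

text \<open>The real inner product is the real part of the Hermitian one, so \<open>adj\<close> is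
  also the adjoint over the reals. Spectral theory can therefore be done entirely in the real
  Euclidean space.\<close>

lemma inner_mult_vec:
  fixes X :: "'n::finite cmat"
  shows "v \<bullet> (X *v w) = (X\<^sup>\<star> *v v) \<bullet> w"
proof -
  have 1: "x \<bullet> (a * y) = (cnj a * x) \<bullet> y" for x a y :: complex
    by (simp add: inner_complex_def algebra_simps)
  have "v \<bullet> (X *v w) = (\<Sum>i\<in>UNIV. \<Sum>j\<in>UNIV. (cnj (X $ i $ j) * v $ i) \<bullet> w $ j)"
    by (simp add: inner_vec_def matrix_vector_mult_def inner_sum_right 1)
  also have "\<dots> = (X\<^sup>\<star> *v v) \<bullet> w"
    by (subst sum.swap) (simp add: inner_vec_def matrix_vector_mult_def inner_sum_left adj_def)
  finally show ?thesis .
qed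

lemma bounded_bilinear_cmat_mult: "bounded_bilinear ((**) :: 'n::finite cmat \<Rightarrow> 'n cmat \<Rightarrow> 'n cmat)"
  unfolding bilinear_conv_bounded_bilinear[symmetric] bilinear_def
  by (auto intro!: linearI simp: cmat_mult_distribs cmat_mult_scaleR)

section \<open>Closure properties of the algebras\<close>

lemma vN_algebra_closed:
  assumes "vN_algebra M"
  shows "mat 1 \<in> M" "\<And>X Y. X \<in> M \<Longrightarrow> Y \<in> M \<Longrightarrow> X + Y \<in> M" "\<And>X Y. X \<in> M \<Longrightarrow> Y \<in> M \<Longrightarrow> X ** Y \<in> M"
    "\<And>c X. X \<in> M \<Longrightarrow> c *\<^sub>C X \<in> M" "\<And>X. X \<in> M \<Longrightarrow> X\<^sup>\<star> \<in> M"
  using assms unfolding vN_algebra_def by blast+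

lemma vN_algebra_scaleR: "vN_algebra M \<Longrightarrow> X \<in> M \<Longrightarrow> r *\<^sub>R X \<in> M"
  by (simp add: vN_algebra_closed scaleR_eq_cscale)

lemma vN_algebra_diff: "vN_algebra M \<Longrightarrow> X \<in> M \<Longrightarrow> Y \<in> M \<Longrightarrow> X - Y \<in> M"
  using vN_algebra_closed(2)[of M X "- 1 *\<^sub>R Y"] vN_algebra_scaleR[of M Y "- 1"] by simp

lemma vN_algebra_0: "vN_algebra M \<Longrightarrow> 0 \<in> M"
  using vN_algebra_diff[of M "mat 1" "mat 1"] by (simp add: vN_algebra_closed)

lemma vN_algebra_sum: "vN_algebra M \<Longrightarrow> (\<And>i. i \<in> I \<Longrightarrow> f i \<in> M) \<Longrightarrow> (\<Sum>i\<in>I. f i) \<in> M"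
  by (induction I rule: infinite_finite_induct) (auto simp: vN_algebra_closed vN_algebra_0)

lemmas vN_algebra_intros =
  vN_algebra_closed vN_algebra_scaleR vN_algebra_diff vN_algebra_0 vN_algebra_sum

lemma vN_algebra_subspace: "vN_algebra M \<Longrightarrow> subspace M"
  by (simp add: subspace_def vN_algebra_intros)

section \<open>The spectral theorem\<close>

lemma eigenspace_iff: "v \<in> eigenspace X \<mu> \<longleftrightarrow> X *v v = \<mu> *\<^sub>R v"
  by (simp add: eigenspace_def vec_eq_iff scaleR_conv_of_real[where 'a = complex])

lemma spec_iff: "\<mu> \<in> spec X \<longleftrightarrow> (\<exists>v. v \<noteq> 0 \<and> X *v v = \<mu> *\<^sub>R v)"
proof -
  have "0 \<in> eigenspace X \<mu>" by (simp add: eigenspace_iff)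
  then have "eigenspace X \<mu> \<noteq> {0} \<longleftrightarrow> (\<exists>v\<in>eigenspace X \<mu>. v \<noteq> 0)" by blast
  then show ?thesis by (auto simp: spec_def eigenspace_iff)
qed

lemma eigenspace_trivial: "\<mu> \<notin> spec X \<Longrightarrow> X *v v = \<mu> *\<^sub>R v \<Longrightarrow> v = 0"
  by (auto simp: spec_iff)

lemma eigenvectors_orthogonal:
  fixes X :: "'n::finite cmat"
  assumes "X\<^sup>\<star> = X" "X *v v = \<mu> *\<^sub>R v" "X *v w = \<nu> *\<^sub>R w" "\<mu> \<noteq> \<nu>"
  shows "v \<bullet> w = 0"
proof -
  have "\<nu> * (v \<bullet> w) = \<mu> * (v \<bullet> w)"
    using inner_mult_vec[of v X w] assms by simp
  with \<open>\<mu> \<noteq> \<nu>\<close> show ?thesis by simp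
qed

text \<open>One eigenvector per eigenvalue gives an orthogonal family of nonzero vectors, hence an
  independent and finite one.\<close>

lemma finite_spec:
  fixes X :: "'n::finite cmat"
  assumes "X\<^sup>\<star> = X"
  shows "finite (spec X)"
proof -
  have "\<forall>\<mu>\<in>spec X. \<exists>v. v \<noteq> 0 \<and> X *v v = \<mu> *\<^sub>R v" by (simp add: spec_iff)
  then obtain f where f: "\<And>\<mu>. \<mu> \<in> spec X \<Longrightarrow> f \<mu> \<noteq> 0 \<and> X *v f \<mu> = \<mu> *\<^sub>R f \<mu>"
    by metis
  have inj: "inj_on f (spec X)"
    by (rule inj_onI) (metis f scaleR_right_imp_eq)
  have "pairwise orthogonal (f ` spec X)"
    unfolding pairwise_def orthogonal_def
    using eigenvectors_orthogonal[OF assms] f by (metis imageE)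
  moreover have "0 \<notin> f ` spec X" using f by force
  ultimately have "independent (f ` spec X)" by (rule pairwise_orthogonal_independent)
  then have "finite (f ` spec X)" by (rule independent_imp_finite)
  with inj show ?thesis by (simp add: finite_image_iff)
qed

text \<open>An eigenvector is a maximiser of the quadratic form on the unit sphere.\<close>

lemma invariant_subspace_eigenvector:
  fixes X :: "'n::finite cmat"
  assumes X: "X\<^sup>\<star> = X" and U: "subspace U" and inv: "\<And>v. v \<in> U \<Longrightarrow> X *v v \<in> U"
    and "u \<in> U" "u \<noteq> 0"
  obtains v \<mu> where "v \<in> U" "v \<noteq> 0" "X *v v = \<mu> *\<^sub>R v"
proof -
  let ?K = "sphere 0 1 \<inter> U"
  have "compact ?K" by (intro compact_Int_closed compact_sphere closed_subspace U)
  moreover have "u /\<^sub>R norm u \<in> ?K"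
    using subspace_scale[OF U \<open>u \<in> U\<close>] \<open>u \<noteq> 0\<close> by simp
  moreover have "continuous_on ?K (\<lambda>v. v \<bullet> (X *v v))"
    by (intro continuous_intros linear_continuous_on matrix_vector_mul_bounded_linear)
  ultimately obtain v where v: "v \<in> ?K" and max: "\<And>w. w \<in> ?K \<Longrightarrow> w \<bullet> (X *v w) \<le> v \<bullet> (X *v v)"
    using continuous_attains_sup[of ?K "\<lambda>v. v \<bullet> (X *v v)"] by blast
  define m where "m = v \<bullet> (X *v v)"
  define Y where "Y w = m *\<^sub>R w - X *v w" for w
  have Y_U: "Y w \<in> U" if "w \<in> U" for w
    unfolding Y_def using that U inv by (simp add: subspace_diff subspace_scale)
  have Y_pos: "0 \<le> w \<bullet> Y w" if "w \<in> U" for w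
  proof (cases "w = 0")
    case False
    have "w /\<^sub>R norm w \<in> ?K" using subspace_scale[OF U that] False by simp
    from max[OF this] have "inverse (norm w) * (inverse (norm w) * (w \<bullet> (X *v w))) \<le> m"
      by (simp add: m_def mult_vec_scaleR)
    then have "(w \<bullet> (X *v w)) / (w \<bullet> w) \<le> m"
      by (simp add: dot_square_norm power2_eq_square divide_inverse mult_ac)
    moreover have "w \<bullet> w > 0" using False by simp
    ultimately have "w \<bullet> (X *v w) \<le> m * (w \<bullet> w)"
      by (simp add: pos_divide_le_eq)
    then show ?thesis by (simp add: Y_def inner_diff_right)
  qed (simp add: Y_def)
  have vv: "v \<bullet> v = 1" using v by (simp add: norm_eq_1)
  have vY: "v \<bullet> Y v = 0" by (simp add: Y_def inner_diff_right vv m_def)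
  have sym: "a \<bullet> Y b = Y a \<bullet> b" for a b
    using inner_mult_vec[of a X b] unfolding X Y_def by (simp add: inner_diff_left inner_diff_right)
  \<comment> \<open>\<open>Y\<close> is positive semidefinite on \<open>U\<close> and its form
    vanishes at \<open>v\<close>. Such a \<open>v\<close> must lie in the kernel: moving from
    \<open>v\<close> against \<open>y\<close> would otherwise make the form negative to first
    order.\<close>
  define y where "y = Y v"
  have "y \<bullet> y = 0"
  proof (rule ccontr)
    assume ne: "y \<bullet> y \<noteq> 0"
    have key: "2 * t * (y \<bullet> y) \<le> t\<^sup>2 * (y \<bullet> Y y)" for t
    proof -
      have "v - t *\<^sub>R y \<in> U" using v Y_U U by (simp add: y_def subspace_diff subspace_scale)
      from Y_pos[OF this] have "0 \<le> (v - t *\<^sub>R y) \<bullet> Y (v - t *\<^sub>R y)" .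
      also have "Y (v - t *\<^sub>R y) = y - t *\<^sub>R Y y"
        unfolding y_def by (simp add: Y_def algebra_simps mult_vec_scaleR)
      also have "(v - t *\<^sub>R y) \<bullet> (y - t *\<^sub>R Y y) = - 2 * t * (y \<bullet> y) + t\<^sup>2 * (y \<bullet> Y y)"
        using vY sym[of v y] by (simp add: inner_diff_left inner_diff_right y_def[symmetric] power2_eq_square right_diff_distrib)
      finally show ?thesis by simp
    qed
    define b where "b = y \<bullet> Y y"
    have pos: "y \<bullet> y > 0" using ne by (simp add: less_le)
    have b: "b \<ge> 0" unfolding b_def by (rule Y_pos) (use v Y_U in \<open>simp add: y_def\<close>)
    \<comment> \<open>Chosen so that \<open>t * b \<le> y \<bullet> y\<close>, which contradicts
      \<open>key\<close>; the added 1 keeps the denominator positive when \<open>b\<close> is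
      0.\<close>
    define t where "t = (y \<bullet> y) / (b + 1)"
    have "t > 0" using pos b by (simp add: t_def)
    with key[of t] have "2 * (y \<bullet> y) \<le> t * b"
      by (simp add: b_def power2_eq_square)
    also have "\<dots> \<le> y \<bullet> y" using b pos by (simp add: t_def field_simps)
    finally show False using pos by simp
  qed
  then have "X *v v = m *\<^sub>R v" by (simp add: y_def Y_def)
  moreover have "v \<noteq> 0" using vv by auto
  ultimately show thesis using v that by blast
qed

text \<open>The orthogonal complement of the eigenvectors is invariant under \<open>X\<close>. If it
  were nontrivial, it would contain an eigenvector, which would be orthogonal to itself.\<close>

lemma span_eigenvectors:
  fixes X :: "'n::finite cmat"
  assumes X: "X\<^sup>\<star> = X"
  shows "span {v. \<exists>\<mu>. X *v v = \<mu> *\<^sub>R v} = UNIV"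
proof (rule ccontr)
  let ?W = "span {v. \<exists>\<mu>. X *v v = \<mu> *\<^sub>R v}"
  let ?U = "{u. \<forall>w\<in>{v. \<exists>\<mu>. X *v v = \<mu> *\<^sub>R v}. orthogonal u w}"
  assume "?W \<noteq> UNIV"
  then obtain u where u: "u \<noteq> 0" "\<And>w. w \<in> ?W \<Longrightarrow> orthogonal u w"
    using span_not_UNIV_orthogonal[of ?W] unfolding span_span orthogonal_def by blast
  have U: "subspace ?U"
    by (auto simp: subspace_def orthogonal_def inner_add_left)
  have inv: "X *v v \<in> ?U" if "v \<in> ?U" for v
  proof -
    have "(X *v v) \<bullet> w = 0" if w: "X *v w = \<mu> *\<^sub>R w" for w \<mu>
    proof -
      have "v \<bullet> w = 0" using \<open>v \<in> ?U\<close> w by (auto simp: orthogonal_def)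
      then show ?thesis using inner_mult_vec[of v X w] X w by simp
    qed
    then show ?thesis by (auto simp: orthogonal_def)
  qed
  have "u \<in> ?U" using u(2) by (auto intro: span_base)
  then obtain v \<mu> where v: "v \<in> ?U" "v \<noteq> 0" "X *v v = \<mu> *\<^sub>R v"
    using invariant_subspace_eigenvector[OF X U inv _ u(1)] by blast
  then have "orthogonal v v" by blast
  with v(2) show False by (simp add: orthogonal_def)
qed

text \<open>The reduction of operator identities to scalar ones: eigenvectors span, so it suffices
  to compare actions on them. Restricting to \<open>\<mu> \<in> spec X\<close> makes facts about
  eigenvalues, such as positivity, available.\<close>

lemma cmat_eqI_eigenvectors:
  fixes X :: "'n::finite cmat"
  assumes X: "X\<^sup>\<star> = X" and eq: "\<And>v \<mu>. \<mu> \<in> spec X \<Longrightarrow> X *v v = \<mu> *\<^sub>R v \<Longrightarrow> Y *v v = Z *v v"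
  shows "Y = Z"
proof -
  have ev: "Y *v w = Z *v w" if w: "X *v w = \<mu> *\<^sub>R w" for w \<mu>
  proof (cases "\<mu> \<in> spec X")
    case False
    then have "w = 0" using w by (rule eigenspace_trivial)
    then show ?thesis by simp
  qed (use eq w in blast)
  have "Y *v v = Z *v v" for v
  proof (rule linear_eq_on_span[where f = "(*v) Y" and g = "(*v) Z"])
    show "v \<in> span {v. \<exists>\<mu>. X *v v = \<mu> *\<^sub>R v}" by (simp add: span_eigenvectors[OF X])
    show "linear ((*v) Y)" "linear ((*v) Z)" by (rule matrix_vector_mul_linear)+
  qed (use ev in blast)
  then show ?thesis by (simp add: matrix_eq)
qed

text \<open>Spectral projections are Lagrange polynomials in the matrix, hence lie in every algebra
  that contains it.\<close>

lemma lagrange_projection: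
  fixes X :: "'n::finite cmat"
  assumes "finite F" "\<mu> \<notin> F"
  shows "\<exists>P. (\<forall>M. vN_algebra M \<longrightarrow> X \<in> M \<longrightarrow> P \<in> M) \<and> (\<forall>v. X *v v = \<mu> *\<^sub>R v \<longrightarrow> P *v v = v) \<and>
    (\<forall>\<nu>\<in>F. \<forall>v. X *v v = \<nu> *\<^sub>R v \<longrightarrow> P *v v = 0)"
  using assms
proof (induction F)
  case empty
  then show ?case by (intro exI[of _ "mat 1"]) (simp add: vN_algebra_closed)
next
  case (insert \<kappa> F)
  then obtain P where P: "\<And>M. vN_algebra M \<Longrightarrow> X \<in> M \<Longrightarrow> P \<in> M" "\<And>v. X *v v = \<mu> *\<^sub>R v \<Longrightarrow> P *v v = v"
    "\<And>\<nu> v. \<nu> \<in> F \<Longrightarrow> X *v v = \<nu> *\<^sub>R v \<Longrightarrow> P *v v = 0" by blast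
  define Q where "Q = P ** ((1 / (\<mu> - \<kappa>)) *\<^sub>R (X - \<kappa> *\<^sub>R mat 1))"
  have Q: "Q *v v = ((\<nu> - \<kappa>) / (\<mu> - \<kappa>)) *\<^sub>R (P *v v)" if "X *v v = \<nu> *\<^sub>R v" for \<nu> v
    unfolding Q_def matrix_vector_mul_assoc[symmetric] scaleR_mult_vec matrix_vector_mult_diff_rdistrib
    using that by (simp add: mult_vec_scaleR matrix_vector_mult_diff_distrib divide_inverse algebra_simps)
  show ?case
  proof (intro exI conjI allI impI ballI)
    fix M assume "vN_algebra M" "X \<in> M"
    then show "Q \<in> M" unfolding Q_def by (intro vN_algebra_intros P)
  next
    fix v assume v: "X *v v = \<mu> *\<^sub>R v"
    show "Q *v v = v" using insert.prems by (simp add: Q[OF v] P(2)[OF v])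
  next
    fix \<nu> v assume "\<nu> \<in> insert \<kappa> F" and v: "X *v v = \<nu> *\<^sub>R v"
    then show "Q *v v = 0" using P(3)[of \<nu> v] by (auto simp: Q[OF v])
  qed
qed

text \<open>The Lagrange polynomial \<open>P\<close> that is 1 at \<mu> and 0 on the rest of the
  spectrum satisfies the description of \<open>sproj\<close>. This also covers \<mu> outside the
  spectrum, where the eigenspace is trivial and the projection is 0.\<close>

lemma sproj_ex:
  fixes X :: "'n::finite cmat"
  assumes X: "X\<^sup>\<star> = X"
  shows "(\<forall>M. vN_algebra M \<longrightarrow> X \<in> M \<longrightarrow> sproj X \<mu> \<in> M) \<and> (sproj X \<mu>)\<^sup>\<star> = sproj X \<mu> \<and>
    (\<forall>\<nu> v. X *v v = \<nu> *\<^sub>R v \<longrightarrow> sproj X \<mu> *v v = (if \<nu> = \<mu> then v else 0))"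
proof -
  obtain P where P: "\<And>M. vN_algebra M \<Longrightarrow> X \<in> M \<Longrightarrow> P \<in> M"
    "\<And>v. X *v v = \<mu> *\<^sub>R v \<Longrightarrow> P *v v = v"
    "\<And>\<nu> v. \<nu> \<in> spec X - {\<mu>} \<Longrightarrow> X *v v = \<nu> *\<^sub>R v \<Longrightarrow> P *v v = 0"
    using lagrange_projection[of "spec X - {\<mu>}" \<mu> X] finite_spec[OF X] by fastforce
  have Pv: "P *v v = (if \<nu> = \<mu> then v else 0)" if "X *v v = \<nu> *\<^sub>R v" for \<nu> v
  proof (cases "\<nu> \<in> spec X")
    case True then show ?thesis using P that by auto
  next
    case False
    then have "v = 0" using that eigenspace_trivial by blast
    then show ?thesis by simp
  qed
  have idem: "P ** P = P"
    by (rule cmat_eqI_eigenvectors[OF X], drule Pv) (simp add: matrix_vector_mul_assoc[symmetric])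
  have "P\<^sup>\<star> = P"
  proof -
    have "P\<^sup>\<star> *v w = P *v w" if w: "X *v w = \<nu> *\<^sub>R w" for w \<nu>
    proof -
      have "(P\<^sup>\<star> *v w) \<bullet> v = (P *v w) \<bullet> v" for v
      proof -
        have "v \<in> span {v. \<exists>\<mu>. X *v v = \<mu> *\<^sub>R v}" by (simp add: span_eigenvectors[OF X])
        then show ?thesis
        proof (rule linear_eq_on_span[rotated 3])
          fix x assume "x \<in> {v. \<exists>\<mu>. X *v v = \<mu> *\<^sub>R v}"
          then obtain \<kappa> where x: "X *v x = \<kappa> *\<^sub>R x" by blast
          show "(P\<^sup>\<star> *v w) \<bullet> x = (P *v w) \<bullet> x"
            unfolding inner_mult_vec[symmetric] Pv[OF x] Pv[OF w]
            using eigenvectors_orthogonal[OF X w x] by auto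
        qed (auto intro!: linearI simp: inner_add_right)
      qed
      then show ?thesis using vector_eq_rdot by blast
    qed
    then show ?thesis by (intro cmat_eqI_eigenvectors[OF X]) auto
  qed
  have rng: "range ((*v) P) = eigenspace X \<mu>"
  proof -
    have "X ** P = \<mu> *\<^sub>R P"
      by (rule cmat_eqI_eigenvectors[OF X], frule Pv) (simp add: matrix_vector_mul_assoc[symmetric] scaleR_mult_vec)
    then have "X *v (P *v v) = \<mu> *\<^sub>R (P *v v)" for v
      by (simp add: matrix_vector_mul_assoc scaleR_mult_vec)
    then show ?thesis by (auto simp: eigenspace_iff) (metis P(2) rangeI)
  qed
  have "sproj X \<mu> = P" unfolding sproj_def
  proof (rule the_equality)
    fix Q assume Q: "Q ** Q = Q \<and> Q\<^sup>\<star> = Q \<and> range ((*v) Q) = eigenspace X \<mu>"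
    \<comment> \<open>Two projections with the same range absorb each other from the left; taking
      adjoints of \<open>Q ** P = P\<close> then gives \<open>P ** Q = P\<close>, so
      \<open>P = Q\<close>.\<close>
    have absorb: "B ** A = A" if "B ** B = B" "range ((*v) A) \<subseteq> range ((*v) B)" for A B :: "'n cmat"
    proof -
      have "B *v (A *v v) = A *v v" for v
      proof -
        obtain w where "A *v v = B *v w" using \<open>range ((*v) A) \<subseteq> range ((*v) B)\<close> by blast
        then show ?thesis using \<open>B ** B = B\<close> by (simp add: matrix_vector_mul_assoc)
      qed
      then show ?thesis by (simp add: matrix_eq matrix_vector_mul_assoc)
    qed
    have "Q ** P = P" "P ** Q = Q" using absorb idem Q rng by auto
    then show "Q = P" using Q \<open>P\<^sup>\<star> = P\<close> by (metis adj_mult)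
  qed (use idem \<open>P\<^sup>\<star> = P\<close> rng in auto)
  then show ?thesis using P(1) \<open>P\<^sup>\<star> = P\<close> Pv by blast
qed

lemma sproj_in_algebra: "X\<^sup>\<star> = X \<Longrightarrow> vN_algebra M \<Longrightarrow> X \<in> M \<Longrightarrow> sproj X \<mu> \<in> M"
  using sproj_ex by blast

lemma adj_sproj: "X\<^sup>\<star> = X \<Longrightarrow> (sproj X \<mu>)\<^sup>\<star> = sproj X \<mu>"
  using sproj_ex by blast

lemma sproj_eigenvector:
  "X\<^sup>\<star> = X \<Longrightarrow> X *v v = \<nu> *\<^sub>R v \<Longrightarrow> sproj X \<mu> *v v = (if \<nu> = \<mu> then v else 0)"
  using sproj_ex by blast

lemma sproj_mult: "X\<^sup>\<star> = X \<Longrightarrow> sproj X \<mu> ** sproj X \<nu> = (if \<mu> = \<nu> then sproj X \<mu> else 0)"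
  by (rule cmat_eqI_eigenvectors[of X], assumption, frule sproj_eigenvector[of X _ _ \<mu>], assumption,
      frule sproj_eigenvector[of X _ _ \<nu>])
    (auto simp: matrix_vector_mul_assoc[symmetric])

section \<open>Functional calculus through eigenvectors\<close>

lemma fun_calc_eigenvector:
  assumes "X\<^sup>\<star> = X" "X *v v = \<nu> *\<^sub>R v"
  shows "fun_calc f X *v v = f \<nu> *\<^sub>R v"
proof (cases "\<nu> \<in> spec X")
  case True
  then show ?thesis using assms finite_spec[OF assms(1)]
    by (simp add: fun_calc_def sum_mult_vec scaleR_mult_vec sproj_eigenvector[OF assms] if_distrib[of "\<lambda>x. _ *\<^sub>R x"] sum.delta' cong: if_cong)
next
  case False
  then have "v = 0" using assms eigenspace_trivial by blast
  then show ?thesis by simp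
qed

lemma fun_calc_eqI:
  assumes "X\<^sup>\<star> = X" "\<And>v \<nu>. \<nu> \<in> spec X \<Longrightarrow> X *v v = \<nu> *\<^sub>R v \<Longrightarrow> Y *v v = f \<nu> *\<^sub>R v"
  shows "fun_calc f X = Y"
  by (rule cmat_eqI_eigenvectors[OF assms(1)]) (simp add: assms fun_calc_eigenvector)

lemma fun_calc_ident: "X\<^sup>\<star> = X \<Longrightarrow> fun_calc (\<lambda>x. x) X = X"
  by (rule fun_calc_eqI) auto

lemma fun_calc_1: "X\<^sup>\<star> = X \<Longrightarrow> fun_calc (\<lambda>x. 1) X = mat 1"
  by (rule fun_calc_eqI) auto

lemma sum_sproj: "X\<^sup>\<star> = X \<Longrightarrow> (\<Sum>\<mu>\<in>spec X. sproj X \<mu>) = mat 1"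
  using fun_calc_1 by (force simp: fun_calc_def)

lemma fun_calc_mult:
  assumes X: "X\<^sup>\<star> = X"
  shows "fun_calc f X ** fun_calc g X = fun_calc (\<lambda>x. f x * g x) X"
proof (rule fun_calc_eqI[OF X, symmetric])
  fix v \<nu> assume v: "X *v v = \<nu> *\<^sub>R v"
  show "fun_calc f X ** fun_calc g X *v v = (f \<nu> * g \<nu>) *\<^sub>R v"
    by (simp add: fun_calc_eigenvector[OF X v] matrix_vector_mul_assoc[symmetric] mult_vec_scaleR)
qed

lemma fun_calc_sproj:
  assumes X: "X\<^sup>\<star> = X"
  shows "fun_calc f X ** sproj X \<mu> = f \<mu> *\<^sub>R sproj X \<mu>" (is ?l)
    and "sproj X \<mu> ** fun_calc f X = f \<mu> *\<^sub>R sproj X \<mu>" (is ?r)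
proof -
  have "fun_calc f X ** sproj X \<mu> *v v = (f \<mu> *\<^sub>R sproj X \<mu>) *v v \<and>
    sproj X \<mu> ** fun_calc f X *v v = (f \<mu> *\<^sub>R sproj X \<mu>) *v v" if v: "X *v v = \<nu> *\<^sub>R v" for v \<nu>
    by (simp add: fun_calc_eigenvector[OF X v] sproj_eigenvector[OF X v] matrix_vector_mul_assoc[symmetric]
        scaleR_mult_vec mult_vec_scaleR)
  then show ?l ?r by (auto intro!: cmat_eqI_eigenvectors[OF X])
qed

lemma fun_calc_in_algebra: "X\<^sup>\<star> = X \<Longrightarrow> vN_algebra M \<Longrightarrow> X \<in> M \<Longrightarrow> fun_calc f X \<in> M"
  unfolding fun_calc_def by (intro vN_algebra_intros sproj_in_algebra)

lemma adj_fun_calc: "X\<^sup>\<star> = X \<Longrightarrow> (fun_calc f X)\<^sup>\<star> = fun_calc f X"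
  by (simp add: fun_calc_def adj_sum adj_scaleR adj_sproj)

lemma spec_mat_1: "spec (mat 1 :: 'n::finite cmat) \<subseteq> {1}"
  by (auto simp: spec_iff) (metis scaleR_one scaleR_right_imp_eq)

lemma fun_calc_mat_1: "fun_calc f (mat 1 :: 'n::finite cmat) = f 1 *\<^sub>R mat 1"
  using spec_mat_1 by (intro fun_calc_eqI) (auto simp: scaleR_mult_vec)

section \<open>Positivity and affine changes of a matrix\<close>

lemma pos_def_spec:
  assumes "pos_def X" "\<mu> \<in> spec X"
  shows "0 < \<mu>"
proof -
  obtain v where v: "v \<noteq> 0" "X *v v = \<mu> *\<^sub>R v" using assms by (auto simp: spec_iff)
  have "0 < v \<bullet> (X *v v)" using assms v unfolding pos_def_def by blast
  also have "v \<bullet> (X *v v) = \<mu> * (v \<bullet> v)" using v by simp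
  finally show ?thesis using inner_ge_zero[of v] by (simp add: zero_less_mult_iff)
qed

lemma spec_lower_bound:
  assumes "pos_def X"
  obtains m where "0 < m" "\<And>x. x \<in> spec X \<Longrightarrow> m \<le> x"
proof (cases "spec X = {}")
  case False
  have fin: "finite (spec X)" using assms by (simp add: pos_def_def finite_spec)
  then have "Min (spec X) \<in> spec X" using False by (rule Min_in)
  then show ?thesis using that[of "Min (spec X)"] pos_def_spec[OF assms] fin by auto
qed (use that[of 1] in auto)

text \<open>With \<open>R\<close> the square root of \<open>X\<close>, the form is
  \<open>\<parallel>R v\<parallel>\<close> squared, and \<open>R\<close> is injective because the
  reciprocal root inverts it.\<close>

lemma pos_defI_spec:
  fixes X :: "'n::finite cmat"
  assumes X: "X\<^sup>\<star> = X" and pos: "\<And>\<mu>. \<mu> \<in> spec X \<Longrightarrow> 0 < \<mu>"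
  shows "pos_def X"
proof -
  let ?R = "fun_calc sqrt X"
  have "?R ** ?R = X"
    unfolding fun_calc_mult[OF X]
    by (rule fun_calc_eqI[OF X]) (use pos in force)
  then have eq: "v \<bullet> (X *v v) = (?R *v v) \<bullet> (?R *v v)" for v
    by (metis X adj_fun_calc inner_mult_vec matrix_vector_mul_assoc)
  have "fun_calc (\<lambda>x. 1 / sqrt x) X ** ?R = mat 1"
    unfolding fun_calc_mult[OF X]
    by (rule fun_calc_eqI[OF X]) (use pos in fastforce)
  then have "?R *v v \<noteq> 0" if "v \<noteq> 0" for v
    using that by (metis matrix_vector_mul_assoc matrix_vector_mul_lid matrix_vector_mult_0_right)
  then show ?thesis using X by (simp add: pos_def_def eq)
qed

lemma eigenspace_affine:
  fixes X :: "'n::finite cmat"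
  assumes "a \<noteq> 0"
  shows "eigenspace (a *\<^sub>R X + b *\<^sub>R mat 1) (a * \<mu> + b) = eigenspace X \<mu>"
proof -
  have "a *\<^sub>R (X *v v) + b *\<^sub>R v = (a * \<mu> + b) *\<^sub>R v \<longleftrightarrow> X *v v = \<mu> *\<^sub>R v" for v
  proof -
    have "a *\<^sub>R (X *v v) + b *\<^sub>R v = (a * \<mu> + b) *\<^sub>R v \<longleftrightarrow> a *\<^sub>R (X *v v) = a *\<^sub>R (\<mu> *\<^sub>R v)"
      by (simp add: scaleR_add_left)
    then show ?thesis using assms by (simp del: scaleR_scaleR)
  qed
  then show ?thesis
    by (simp add: set_eq_iff eigenspace_iff matrix_vector_mult_add_rdistrib scaleR_mult_vec)
qed

text \<open>\<open>sproj\<close> depends on the matrix only through the eigenspace, so the two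
  defining descriptions coincide literally.\<close>

lemma sproj_affine:
  fixes X :: "'n::finite cmat"
  shows "a \<noteq> 0 \<Longrightarrow> sproj (a *\<^sub>R X + b *\<^sub>R mat 1) (a * \<mu> + b) = sproj X \<mu>"
  by (simp add: sproj_def eigenspace_affine)

lemma spec_affine:
  fixes X :: "'n::finite cmat"
  assumes "a \<noteq> 0"
  shows "spec (a *\<^sub>R X + b *\<^sub>R mat 1) = (\<lambda>\<mu>. a * \<mu> + b) ` spec X"
proof -
  have "\<nu> \<in> spec (a *\<^sub>R X + b *\<^sub>R mat 1) \<longleftrightarrow> (\<nu> - b) / a \<in> spec X" for \<nu>
    using eigenspace_affine[OF assms, of X b "(\<nu> - b) / a"] assms by (simp add: spec_def)
  then show ?thesis using assms by (force simp: image_iff)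
qed

section \<open>The logarithmic mean\<close>

lemma log_mean_commute: "log_mean r s = log_mean s r"
  by (auto simp: log_mean_def) (metis minus_diff_eq minus_divide_divide)

text \<open>The order of the difference matches \<open>pd\<close>, where the right factor enters
  with a plus sign and the left one with a minus sign.\<close>

lemma log_mean_mult_ln_diff:
  assumes "0 < r" "0 < s"
  shows "log_mean r s * (ln s - ln r) = s - r"
  using assms by (auto simp: log_mean_def field_simps)

text \<open>For r < s this is \<open>ln (s / r) \<le> s / r - 1\<close> multiplied by r; symmetry of
  the mean gives the other order.\<close>

lemma log_mean_ge_min:
  assumes "0 < m" "m \<le> r" "m \<le> s"
  shows "m \<le> log_mean r s"
proof -
  have *: "m \<le> log_mean r s" if "r < s" "m \<le> r" for r s
  proof -
    have pos: "0 < ln s - ln r" using that \<open>0 < m\<close> by simp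
    have "ln s - ln r = ln (s / r)" using that \<open>0 < m\<close> by (simp add: ln_div)
    also have "\<dots> \<le> s / r - 1" using that \<open>0 < m\<close> by (intro ln_le_minus_one) simp
    finally have "r * (ln s - ln r) \<le> s - r" using that \<open>0 < m\<close> by (simp add: field_simps)
    then have "r \<le> (s - r) / (ln s - ln r)" using pos by (simp add: field_simps)
    also have "\<dots> = log_mean s r" using that \<open>0 < m\<close> by (simp add: log_mean_def)
    finally show ?thesis using that by (simp add: log_mean_commute)
  qed
  consider "r < s" | "r = s" | "s < r" by linarith
  then show ?thesis
  proof cases
    case 2
    then show ?thesis using assms by (simp add: log_mean_def)
  next
    case 3
    then show ?thesis using * assms log_mean_commute by metis
  qed (use * assms in blast)
qed

text \<open>The affine map stretches the difference of the arguments by exactly 1 + t, and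
  subtracting t from both increases their ratio. So the numerator of the mean grows by 1 + t while
  the logarithmic denominator does not shrink.\<close>

lemma log_mean_affine_le:
  assumes "0 < r" "0 < s" "0 \<le> t" "0 < (1 + t) * r - t" "0 < (1 + t) * s - t"
  shows "log_mean ((1 + t) * r - t) ((1 + t) * s - t) \<le> (1 + t) * log_mean r s"
proof -
  have *: "log_mean ((1 + t) * r - t) ((1 + t) * s - t) \<le> (1 + t) * log_mean r s"
    if "s < r" "0 < s" "0 < (1 + t) * s - t" for r s
  proof -
    define a b where "a = (1 + t) * r - t" and "b = (1 + t) * s - t"
    have "b < a" using that \<open>0 \<le> t\<close> by (simp add: a_def b_def mult_strict_left_mono)
    have "0 < b" using that by (simp add: b_def)
    \<comment> \<open>After expansion this is \<open>t * s \<le> t * r\<close>; it says that the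
      ratio a / b is at least r / s.\<close>
    have "r * b \<le> a * s" using that \<open>0 \<le> t\<close> mult_left_mono[of s r t] by (simp add: a_def b_def algebra_simps)
    then have "ln (r * b) \<le> ln (a * s)"
      using that \<open>0 < b\<close> \<open>b < a\<close> by (subst ln_le_cancel_iff) auto
    then have le: "ln r - ln s \<le> ln a - ln b"
      using that \<open>0 < b\<close> \<open>b < a\<close> by (simp add: ln_mult)
    have "log_mean a b = (1 + t) * (r - s) / (ln a - ln b)"
      using \<open>b < a\<close> \<open>0 < b\<close> by (simp add: log_mean_def a_def b_def algebra_simps)
    also have "\<dots> \<le> (1 + t) * (r - s) / (ln r - ln s)"
      using le that \<open>0 \<le> t\<close> \<open>b < a\<close> \<open>0 < b\<close> by (intro divide_left_mono mult_pos_pos) auto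
    also have "\<dots> = (1 + t) * log_mean r s" using that by (simp add: log_mean_def)
    finally show ?thesis by (simp add: a_def b_def)
  qed
  consider "r < s" | "r = s" | "s < r" by linarith
  then show ?thesis
  proof cases
    case 2
    then show ?thesis using assms by (simp add: log_mean_def algebra_simps)
  next
    case 1
    then show ?thesis using *[of r s] assms log_mean_commute by metis
  qed (use * assms in blast)
qed

section \<open>Linear maps and forms on subspaces\<close>

text \<open>Traces and the operators \<open>Kop S \<rho>\<close> are linear only on an algebra or a
  tangent space; the extension makes results on globally linear maps applicable to them.\<close>

lemma linear_on_subspace_extend:
  fixes f :: "'a::real_vector \<Rightarrow> 'b::real_vector"
  assumes M: "subspace M"
    and add: "\<And>x y. x \<in> M \<Longrightarrow> y \<in> M \<Longrightarrow> f (x + y) = f x + f y"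
    and scale: "\<And>r x. x \<in> M \<Longrightarrow> f (r *\<^sub>R x) = r *\<^sub>R f x"
  obtains g where "linear g" "\<And>x. x \<in> M \<Longrightarrow> g x = f x"
proof -
  obtain B where B: "B \<subseteq> M" "independent B" "M \<subseteq> span B" by (rule maximal_independent_subset)
  obtain g where g: "linear g" "\<And>x. x \<in> B \<Longrightarrow> g x = f x"
    using linear_independent_extend[OF B(2), of f] by blast
  have "subspace {x \<in> M. g x = f x}"
    using M add scale scale[of _ 0] g(1)
    by (auto simp: subspace_def linear_add linear_scale linear_0)
  then have "span B \<subseteq> {x \<in> M. g x = f x}"
    using B g by (intro span_minimal) auto
  with B g show thesis by (intro that[of g]) auto
qed

lemma injective_endomorphism_surj:
  fixes f :: "'a::euclidean_space \<Rightarrow> 'a"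
  assumes M: "subspace M"
    and add: "\<And>x y. x \<in> M \<Longrightarrow> y \<in> M \<Longrightarrow> f (x + y) = f x + f y"
    and scale: "\<And>r x. x \<in> M \<Longrightarrow> f (r *\<^sub>R x) = r *\<^sub>R f x"
    and into: "\<And>x. x \<in> M \<Longrightarrow> f x \<in> M"
    and ker: "\<And>x. x \<in> M \<Longrightarrow> f x = 0 \<Longrightarrow> x = 0"
  shows "bij_betw f M M"
proof -
  obtain g where g: "linear g" "\<And>x. x \<in> M \<Longrightarrow> g x = f x"
    using linear_on_subspace_extend[OF M add scale] by blast
  have inj: "inj_on g M"
  proof (rule inj_onI)
    fix x y assume xy: "x \<in> M" "y \<in> M" "g x = g y"
    then have "g (x - y) = 0" using g(1) by (simp add: linear_diff)
    then show "x = y" using ker[of "x - y"] g(2)[of "x - y"] M xy by (simp add: subspace_diff)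
  qed
  have "dim (g ` M) = dim M"
    using dim_image_eq[OF g(1), of M] inj M by (metis span_eq_iff)
  then have "g ` M = M"
    using g into M by (intro subspace_dim_equal linear_subspace_image) auto
  with inj have "bij_betw g M M" by (simp add: bij_betw_def)
  then show ?thesis using g(2) by (simp cong: bij_betw_cong)
qed

text \<open>Symmetry of \<open>b\<close> is replaced by a dimension count: the map \<open>T\<close>
  collecting the values of \<open>b\<close> on an orthonormal basis is injective, since
  \<open>T y = 0\<close> forces \<open>b y y = 0\<close>, and is therefore onto.\<close>

lemma riesz_representation_subspace:
  fixes b :: "'a::euclidean_space \<Rightarrow> 'a \<Rightarrow> real"
  assumes M: "subspace M"
    and add_l: "\<And>x y z. x \<in> M \<Longrightarrow> y \<in> M \<Longrightarrow> z \<in> M \<Longrightarrow> b (x + y) z = b x z + b y z"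
    and scale_l: "\<And>r x z. x \<in> M \<Longrightarrow> z \<in> M \<Longrightarrow> b (r *\<^sub>R x) z = r * b x z"
    and add_r: "\<And>x y z. x \<in> M \<Longrightarrow> y \<in> M \<Longrightarrow> z \<in> M \<Longrightarrow> b z (x + y) = b z x + b z y"
    and scale_r: "\<And>r x z. x \<in> M \<Longrightarrow> z \<in> M \<Longrightarrow> b z (r *\<^sub>R x) = r * b z x"
    and nondeg: "\<And>x. x \<in> M \<Longrightarrow> b x x = 0 \<Longrightarrow> x = 0"
    and f_add: "\<And>x y. x \<in> M \<Longrightarrow> y \<in> M \<Longrightarrow> f (x + y) = f x + f y"
    and f_scale: "\<And>r x. x \<in> M \<Longrightarrow> f (r *\<^sub>R x) = r * f x"
  obtains y where "y \<in> M" "\<And>x. x \<in> M \<Longrightarrow> b x y = f x"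
proof -
  obtain B where B: "B \<subseteq> M" "pairwise orthogonal B" "\<And>x. x \<in> B \<Longrightarrow> norm x = 1"
    "independent B" "span B = M"
    using orthonormal_basis_subspace[OF M] by metis
  have fin: "finite B" using B(4) by (rule independent_imp_finite)
  have coord: "(\<Sum>e\<in>B. u e *\<^sub>R e) \<bullet> e' = u e'" if "e' \<in> B" for u e'
  proof -
    have "(\<Sum>e\<in>B. u e *\<^sub>R e) \<bullet> e' = (\<Sum>e\<in>B. if e = e' then u e else 0)"
      unfolding inner_sum_left
    proof (rule sum.cong)
      fix e assume "e \<in> B"
      then show "(u e *\<^sub>R e) \<bullet> e' = (if e = e' then u e else 0)"
        using B(2,3) that by (auto simp: pairwise_def orthogonal_def dot_square_norm)
    qed simp
    also have "\<dots> = u e'" using that fin by simp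
    finally show ?thesis .
  qed
  define T where "T y = (\<Sum>e\<in>B. b e y *\<^sub>R e)" for y
  \<comment> \<open>Stated for an arbitrary functional because it is used twice: with the zero
    functional for injectivity of \<open>T\<close>, and with the given one for the
    conclusion.\<close>
  have ext: "b x y = f x" if "x \<in> M" "y \<in> M" and eq: "\<And>e. e \<in> B \<Longrightarrow> b e y = f e"
    and f_add: "\<And>x y. x \<in> M \<Longrightarrow> y \<in> M \<Longrightarrow> f (x + y) = f x + f y"
    and f_scale: "\<And>r x. x \<in> M \<Longrightarrow> f (r *\<^sub>R x) = r * f x" for x y f
  proof -
    have "subspace {x \<in> M. b x y = f x}"
      using M add_l scale_l f_add f_scale \<open>y \<in> M\<close> scale_l[of 0 y 0] f_scale[of 0 0]
      by (auto simp: subspace_def)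
    then have "span B \<subseteq> {x \<in> M. b x y = f x}" using B(1) eq by (intro span_minimal) auto
    with B(5) \<open>x \<in> M\<close> show ?thesis by blast
  qed
  have "bij_betw T M M"
  proof (rule injective_endomorphism_surj[OF M])
    fix x y assume "x \<in> M" "y \<in> M"
    then show "T (x + y) = T x + T y"
      unfolding T_def sum.distrib[symmetric] using B(1) by (intro sum.cong) (auto simp: add_r scaleR_add_left)
  next
    fix r x assume "x \<in> M"
    then show "T (r *\<^sub>R x) = r *\<^sub>R T x"
      unfolding T_def scaleR_sum_right using B(1) by (intro sum.cong) (auto simp: scale_r)
  next
    fix x assume "x \<in> M"
    show "T x \<in> M" unfolding T_def using B(1) M by (intro subspace_sum subspace_scale) auto
  next
    fix x assume x: "x \<in> M" and "T x = 0"
    then have "b e x = 0" if "e \<in> B" for e using coord[OF that, of "\<lambda>e. b e x"] by (simp add: T_def)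
    then have "b x x = 0" using ext[of x x "\<lambda>_. 0"] x by simp
    then show "x = 0" using nondeg x by blast
  qed
  moreover have "(\<Sum>e\<in>B. f e *\<^sub>R e) \<in> M" using B(1) M by (intro subspace_sum subspace_scale) auto
  ultimately obtain y where y: "y \<in> M" "T y = (\<Sum>e\<in>B. f e *\<^sub>R e)"
    by (metis bij_betw_imp_surj_on imageE)
  then have "b e y = f e" if "e \<in> B" for e
    using coord[OF that, of "\<lambda>e. b e y"] coord[OF that, of f] by (simp add: T_def)
  then show thesis using that[of y] ext[of _ y f] y(1) f_add f_scale by blast
qed

text \<open>Pairing with the component \<open>z\<close> of the derivative orthogonal to
  \<open>M\<close> gives a locally constant function, so that component vanishes. It shows that
  velocities of curves of states are tangent.\<close>

lemma vector_derivative_in_subspace: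
  fixes c :: "real \<Rightarrow> 'a::euclidean_space"
  assumes M: "subspace M" and c: "(c has_vector_derivative v) (at s)"
    and ev: "\<forall>\<^sub>F u in nhds s. c u - c s \<in> M"
  shows "v \<in> M"
proof -
  obtain y z where y: "y \<in> span M" and z: "\<And>w. w \<in> span M \<Longrightarrow> orthogonal z w" and v: "v = y + z"
    using orthogonal_subspace_decomp_exists[of M v] by blast
  have "((\<lambda>u. c u \<bullet> z) has_real_derivative v \<bullet> z) (at s)"
    using bounded_linear.has_vector_derivative[OF bounded_linear_inner_left c, of z]
    by (simp add: has_real_derivative_iff_has_vector_derivative)
  moreover have "((\<lambda>u. c u \<bullet> z) has_real_derivative 0) (at s)"
  proof (rule DERIV_cong_ev[THEN iffD1, OF refl _ refl])
    show "((\<lambda>u. c s \<bullet> z) has_real_derivative 0) (at s)" by simp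
    show "\<forall>\<^sub>F u in nhds s. c s \<bullet> z = c u \<bullet> z"
      using ev
    proof eventually_elim
      case (elim u)
      then have "(c u - c s) \<bullet> z = 0" using z span_base by (metis inner_commute orthogonal_def)
      then show ?case by (simp add: inner_diff_left)
    qed
  qed
  ultimately have "v \<bullet> z = 0" by (rule DERIV_unique)
  moreover have "z \<bullet> y = 0" using z[OF y] by (simp add: orthogonal_def)
  ultimately have "z = 0" by (simp add: v inner_add_left inner_add_right inner_commute)
  with y v M show ?thesis by (metis add.right_neutral span_eq_iff)
qed

section \<open>Tracial algebras\<close>

locale tracial_algebra =
  fixes M :: "'n::finite cmat set" and t :: "'n cmat \<Rightarrow> complex"
  assumes vN: "vN_algebra M" and faithful: "faithful_trace M t"
begin

lemmas mem = vN_algebra_intros[OF vN]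

lemma trace_add: "X \<in> M \<Longrightarrow> Y \<in> M \<Longrightarrow> t (X + Y) = t X + t Y"
  using faithful unfolding faithful_trace_def by blast

lemma trace_cscale: "X \<in> M \<Longrightarrow> t (c *\<^sub>C X) = c * t X"
  using faithful unfolding faithful_trace_def by blast

lemma trace_comm: "X \<in> M \<Longrightarrow> Y \<in> M \<Longrightarrow> t (X ** Y) = t (Y ** X)"
  using faithful unfolding faithful_trace_def by blast

lemma trace_nonneg: "X \<in> M \<Longrightarrow> Im (t (X\<^sup>\<star> ** X)) = 0 \<and> 0 \<le> Re (t (X\<^sup>\<star> ** X))"
  using faithful unfolding faithful_trace_def by blast

lemma trace_eq_0: "X \<in> M \<Longrightarrow> t (X\<^sup>\<star> ** X) = 0 \<Longrightarrow> X = 0"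
  using faithful unfolding faithful_trace_def by blast

lemma trace_scaleR: "X \<in> M \<Longrightarrow> t (r *\<^sub>R X) = of_real r * t X"
  by (simp add: scaleR_eq_cscale trace_cscale)

lemma trace_diff: "X \<in> M \<Longrightarrow> Y \<in> M \<Longrightarrow> t (X - Y) = t X - t Y"
  using trace_add[of X "- 1 *\<^sub>R Y"] trace_scaleR[of Y "- 1"] mem(6)[of Y "- 1"] by simp

lemma trace_0: "t 0 = 0"
  using trace_diff[of "mat 1" "mat 1"] by (simp add: mem)

lemma trace_sum: "(\<And>i. i \<in> I \<Longrightarrow> f i \<in> M) \<Longrightarrow> t (\<Sum>i\<in>I. f i) = (\<Sum>i\<in>I. t (f i))"
  by (induction I rule: infinite_finite_induct) (auto simp: trace_0 trace_add mem)

text \<open>Positivity alone makes the trace Hermitian: expanding the positive number belonging to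
  \<open>Y + mat 1\<close> shows that \<open>t (Y\<^sup>\<star>) + t Y\<close> is real, and this is
  applied to \<open>X\<close> and to \<open>\<i> *\<^sub>C X\<close>.\<close>

lemma trace_adj:
  assumes X: "X \<in> M"
  shows "t (X\<^sup>\<star>) = cnj (t X)"
proof -
  have im: "Im (t (Y\<^sup>\<star>) + t Y) = 0" if Y: "Y \<in> M" for Y
  proof -
    have "t ((Y + mat 1)\<^sup>\<star> ** (Y + mat 1)) = t (Y\<^sup>\<star> ** Y) + t (Y\<^sup>\<star>) + t Y + t ((mat 1)\<^sup>\<star> ** mat 1)"
      using Y by (simp add: adj_add cmat_mult_distribs trace_add mem)
    then show ?thesis
      using trace_nonneg[of "Y + mat 1"] trace_nonneg[OF Y] trace_nonneg[of "mat 1"] Y by (simp add: mem)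
  qed
  have "(\<i> *\<^sub>C X)\<^sup>\<star> = (- \<i>) *\<^sub>C X\<^sup>\<star>"
    by (simp add: cscale_def adj_def vec_eq_iff)
  then have "Im (- \<i> * t (X\<^sup>\<star>) + \<i> * t X) = 0"
    using im[of "\<i> *\<^sub>C X"] X by (simp add: mem trace_cscale)
  with im[OF X] show ?thesis by (simp add: complex_eq_iff)
qed

lemma trace_selfadjoint_real: "X \<in> M \<Longrightarrow> X\<^sup>\<star> = X \<Longrightarrow> Im (t X) = 0"
  by (metis trace_adj complex_cnj_cancel_iff Reals_cnj_iff complex_is_Real_iff)

lemma trace_nondegenerate:
  "Y \<in> M \<Longrightarrow> (\<And>X. X \<in> M \<Longrightarrow> t (X\<^sup>\<star> ** Y) = 0) \<Longrightarrow> Y = 0"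
  using trace_eq_0 by blast

lemma eq_by_trace:
  assumes "Y \<in> M" "Z \<in> M" "\<And>X. X \<in> M \<Longrightarrow> t (X\<^sup>\<star> ** Y) = t (X\<^sup>\<star> ** Z)"
  shows "Y = Z"
proof -
  have "Y - Z = 0"
    using assms by (intro trace_nondegenerate) (auto simp: mem cmat_mult_distribs trace_diff)
  then show ?thesis by simp
qed

text \<open>The real representation theorem settles the real parts; testing with
  \<open>\<i> *\<^sub>C X\<close> turns them into the imaginary parts.\<close>

lemma antilinear_representation:
  assumes add: "\<And>X Y. X \<in> M \<Longrightarrow> Y \<in> M \<Longrightarrow> f (X + Y) = f X + f Y"
    and scale: "\<And>c X. X \<in> M \<Longrightarrow> f (c *\<^sub>C X) = cnj c * f X"
  obtains Y where "Y \<in> M" "\<And>X. X \<in> M \<Longrightarrow> t (X\<^sup>\<star> ** Y) = f X"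
proof -
  have pos: "X = 0" if "X \<in> M" "Re (t (X\<^sup>\<star> ** X)) = 0" for X
    using that trace_nonneg[of X] trace_eq_0[of X] by (simp add: complex_eq_iff)
  obtain Y where Y: "Y \<in> M" and eq: "\<And>X. X \<in> M \<Longrightarrow> Re (t (X\<^sup>\<star> ** Y)) = Re (f X)"
  proof (rule riesz_representation_subspace[of M "\<lambda>X Y. Re (t (X\<^sup>\<star> ** Y))" "\<lambda>X. Re (f X)"])
    show "subspace M" using vN by (rule vN_algebra_subspace)
    show "\<And>x. x \<in> M \<Longrightarrow> Re (t (x\<^sup>\<star> ** x)) = 0 \<Longrightarrow> x = 0" by (rule pos)
    fix r x assume "x \<in> M"
    then show "Re (f (r *\<^sub>R x)) = r * Re (f x)" by (simp add: scaleR_eq_cscale scale)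
  qed (auto simp: adj_add adj_scaleR cmat_mult_distribs cmat_mult_scaleR trace_add trace_scaleR add mem)
  have "t (X\<^sup>\<star> ** Y) = f X" if X: "X \<in> M" for X
  proof -
    have "(\<i> *\<^sub>C X)\<^sup>\<star> = (- \<i>) *\<^sub>C X\<^sup>\<star>" by (simp add: cscale_def adj_def vec_eq_iff)
    then have "Im (t (X\<^sup>\<star> ** Y)) = Im (f X)"
      using eq[of "\<i> *\<^sub>C X"] X Y by (simp add: mem scale cmat_mult_cscale trace_cscale)
    with eq[OF X] show ?thesis by (simp add: complex_eq_iff)
  qed
  with Y show thesis by (rule that)
qed

text \<open>By cyclicity the trace of \<open>P ** Q\<close> equals that of
  \<open>(P ** Q)\<^sup>\<star> ** (P ** Q)\<close>.\<close>

lemma trace_proj_mult_nonneg: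
  assumes "P \<in> M" "Q \<in> M" "P\<^sup>\<star> = P" "Q\<^sup>\<star> = Q" "P ** P = P" "Q ** Q = Q"
  shows "0 \<le> Re (t (P ** Q))"
proof -
  have "(P ** Q)\<^sup>\<star> ** (P ** Q) = (Q ** P) ** Q"
    using assms by (simp add: adj_mult) (metis matrix_mul_assoc)
  then have "t ((P ** Q)\<^sup>\<star> ** (P ** Q)) = t (Q ** (Q ** P))"
    using trace_comm[of "Q ** P" Q] assms by (simp add: mem)
  also have "\<dots> = t (P ** Q)"
    using trace_comm[of P Q] assms by (simp add: matrix_mul_assoc)
  finally show ?thesis using trace_nonneg[of "P ** Q"] assms by (simp add: mem)
qed

text \<open>The joint spectral expansion of two matrices that need not commute. Its weights are
  nonnegative and independent of \<open>f\<close> and \<open>g\<close>, so scalar inequalities in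
  (y, x) pass to traces.\<close>

lemma trace_fun_calc_mult:
  assumes "X \<in> M" "Y \<in> M" "X\<^sup>\<star> = X" "Y\<^sup>\<star> = Y"
  shows "Re (t (fun_calc f Y ** fun_calc g X)) =
    (\<Sum>y\<in>spec Y. \<Sum>x\<in>spec X. f y * g x * Re (t (sproj Y y ** sproj X x)))"
  using assms
  by (simp add: fun_calc_def cmat_mult_sum cmat_mult_scaleR trace_sum trace_scaleR mem sproj_in_algebra vN
      mult_ac sum_distrib_left) (simp add: sum.swap[of _ "spec X" "spec Y"] mult_ac)

text \<open>Both bounds hold for the scalar function
  \<open>y ln y - y ln x - y + x\<close>, which lies between \<open>0\<close> and \<open>(y - x)\<^sup>2 / x\<close>.\<close>

lemma klein_inequality:
  assumes X: "X \<in> M" "X\<^sup>\<star> = X" and Y: "Y \<in> M" "Y\<^sup>\<star> = Y"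
    and pos: "\<And>y. y \<in> spec Y \<Longrightarrow> 0 < y" and m: "0 < m" "\<And>x. x \<in> spec X \<Longrightarrow> m \<le> x"
    and eq: "t X = t Y"
  shows "0 \<le> Re (t (Y ** fun_calc ln Y)) - Re (t (Y ** fun_calc ln X))"
    and "Re (t (Y ** fun_calc ln Y)) - Re (t (Y ** fun_calc ln X)) \<le> Re (t ((Y - X) ** (Y - X))) / m"
proof -
  define W where "W y x = Re (t (sproj Y y ** sproj X x))" for y x
  have W: "0 \<le> W y x" for y x
    unfolding W_def using X Y
    by (intro trace_proj_mult_nonneg) (auto simp: sproj_in_algebra vN adj_sproj sproj_mult)
  have F: "Re (t (fun_calc f Y ** fun_calc g X)) = (\<Sum>y\<in>spec Y. \<Sum>x\<in>spec X. f y * g x * W y x)" for f g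
    unfolding W_def using X Y by (intro trace_fun_calc_mult)
  note id = fun_calc_ident[OF X(2)] fun_calc_ident[OF Y(2)] fun_calc_1[OF X(2)] fun_calc_1[OF Y(2)]
  note mem' = mem fun_calc_in_algebra[OF X(2) vN X(1)] fun_calc_in_algebra[OF Y(2) vN Y(1)] X(1) Y(1)
  have 1: "Re (t (Y ** fun_calc ln Y)) - Re (t (Y ** fun_calc ln X)) =
      (\<Sum>y\<in>spec Y. \<Sum>x\<in>spec X. (y * ln y - y * ln x - y + x) * W y x)"
    (is "?L = _")
  proof -
    have "fun_calc (\<lambda>y. y * ln y) Y = Y ** fun_calc ln Y"
      using fun_calc_mult[OF Y(2), of "\<lambda>y. y" ln] by (simp add: id)
    \<comment> \<open>Equality of the traces allows the terms - y + x to be inserted, which turn the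
      summand into a nonnegative function of (y, x).\<close>
    moreover have "Re (t X) = Re (t Y)" by (simp add: eq)
    ultimately have "?L = Re (t (fun_calc (\<lambda>y. y * ln y) Y ** fun_calc (\<lambda>x. 1) X))
        - Re (t (fun_calc (\<lambda>y. y) Y ** fun_calc ln X))
        - Re (t (fun_calc (\<lambda>y. y) Y ** fun_calc (\<lambda>x. 1) X))
        + Re (t (fun_calc (\<lambda>y. 1) Y ** fun_calc (\<lambda>x. x) X))"
      by (simp add: id)
    then show ?thesis
      unfolding F by (simp add: sum_subtractf sum.distrib algebra_simps)
  qed
  have 2: "Re (t ((Y - X) ** (Y - X))) = (\<Sum>y\<in>spec Y. \<Sum>x\<in>spec X. (y - x)\<^sup>2 * W y x)"
  proof -
    have "fun_calc (\<lambda>y. y * y) Y = Y ** Y" "fun_calc (\<lambda>x. x * x) X = X ** X"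
      using fun_calc_mult[OF Y(2), of "\<lambda>y. y" "\<lambda>y. y"] fun_calc_mult[OF X(2), of "\<lambda>y. y" "\<lambda>y. y"] by (simp_all add: id)
    moreover have "Re (t ((Y - X) ** (Y - X))) = Re (t (Y ** Y)) - 2 * Re (t (Y ** X)) + Re (t (X ** X))"
      using trace_comm[of X Y] by (simp add: cmat_mult_distribs trace_diff mem')
    ultimately have "Re (t ((Y - X) ** (Y - X))) =
        Re (t (fun_calc (\<lambda>y. y * y) Y ** fun_calc (\<lambda>x. 1) X))
        - 2 * Re (t (fun_calc (\<lambda>y. y) Y ** fun_calc (\<lambda>x. x) X))
        + Re (t (fun_calc (\<lambda>y. 1) Y ** fun_calc (\<lambda>x. x * x) X))"
      by (simp add: id)
    then show ?thesis
      unfolding F by (simp add: sum_subtractf sum.distrib sum_distrib_left power2_eq_square algebra_simps)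
  qed
  have scalar: "0 \<le> y * ln y - y * ln x - y + x" "y * ln y - y * ln x - y + x \<le> (y - x)\<^sup>2 / m"
    if "y \<in> spec Y" "x \<in> spec X" for x y
  proof -
    have xy: "0 < y" "0 < x" "m \<le> x" using pos m that by force+
    have "ln x - ln y \<le> x / y - 1" using ln_le_minus_one[of "x / y"] xy by (simp add: ln_div)
    then have "y * (ln x - ln y) \<le> y * (x / y - 1)" using xy by (intro mult_left_mono) auto
    then show "0 \<le> y * ln y - y * ln x - y + x" using xy by (simp add: algebra_simps)
    have "ln y - ln x \<le> y / x - 1" using ln_le_minus_one[of "y / x"] xy by (simp add: ln_div)
    then have "y * (ln y - ln x) \<le> y * (y / x - 1)" using xy by (intro mult_left_mono) auto
    then have "y * ln y - y * ln x - y + x \<le> y * (y / x - 1) - y + x" by (simp add: algebra_simps)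
    also have "\<dots> = (y - x)\<^sup>2 / x" using xy by (simp add: power2_eq_square field_simps)
    also have "\<dots> \<le> (y - x)\<^sup>2 / m" using xy m by (intro divide_left_mono) auto
    finally show "y * ln y - y * ln x - y + x \<le> (y - x)\<^sup>2 / m" .
  qed
  show "0 \<le> ?L" unfolding 1 by (intro sum_nonneg mult_nonneg_nonneg scalar W)
  have "?L \<le> (\<Sum>y\<in>spec Y. \<Sum>x\<in>spec X. (y - x)\<^sup>2 / m * W y x)"
    unfolding 1 by (intro sum_mono mult_right_mono scalar W)
  then show "?L \<le> Re (t ((Y - X) ** (Y - X))) / m"
    unfolding 2 by (simp add: sum_divide_distrib)
qed

lemma trace_bounded_linear_extension:
  obtains T :: "'n cmat \<Rightarrow> real" where "bounded_linear T" "\<And>X. X \<in> M \<Longrightarrow> T X = Re (t X)"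
proof -
  have "Re (t (X + Y)) = Re (t X) + Re (t Y)" "Re (t (r *\<^sub>R X)) = r *\<^sub>R Re (t X)"
    if "X \<in> M" "Y \<in> M" for X Y r
    using that by (simp_all add: trace_add trace_scaleR)
  then obtain T where "linear T" "\<And>X. X \<in> M \<Longrightarrow> T X = Re (t X)"
    using linear_on_subspace_extend[OF vN_algebra_subspace[OF vN], of "\<lambda>X. Re (t X)"] by blast
  then show thesis by (intro that[of T]) (simp_all add: linear_conv_bounded_linear)
qed

text \<open>The logarithm is frozen at \<open>Z = fun_calc ln (c s)\<close>. The remainder
  \<open>h\<close> is the relative entropy of \<open>c u\<close> and \<open>c s\<close>; the Klein
  inequality, which uses the constant trace, squeezes it between 0 and the quadratic
  \<open>q\<close>, so \<open>h\<close> has derivative 0 at s.\<close>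

lemma has_derivative_trace_ln:
  assumes c: "(c has_vector_derivative v) (at s)" and v: "v \<in> M"
    and ev: "\<forall>\<^sub>F u in nhds s. c u \<in> M \<and> pos_def (c u) \<and> t (c u) = r"
  shows "((\<lambda>u. Re (t (c u ** fun_calc ln (c u)))) has_real_derivative Re (t (v ** fun_calc ln (c s)))) (at s)"
proof -
  obtain T where T: "bounded_linear T" "\<And>X. X \<in> M \<Longrightarrow> T X = Re (t X)"
    using trace_bounded_linear_extension by blast
  interpret mm: bounded_bilinear "(**) :: 'n cmat \<Rightarrow> 'n cmat \<Rightarrow> 'n cmat" by (rule bounded_bilinear_cmat_mult)
  define X where "X = c s"
  have X: "X \<in> M" "pos_def X" "X\<^sup>\<star> = X" "t X = r"
    using eventually_nhds_x_imp_x[OF ev] by (auto simp: X_def pos_def_def)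
  define Z where "Z = fun_calc ln X"
  have Z: "Z \<in> M" using X by (simp add: Z_def fun_calc_in_algebra vN)
  obtain m where m: "0 < m" "\<And>x. x \<in> spec X \<Longrightarrow> m \<le> x"
    using spec_lower_bound[OF X(2)] by blast
  define h where "h u = Re (t (c u ** fun_calc ln (c u))) - T (c u ** Z)" for u
  define q where "q u = T ((c u - X) ** (c u - X)) / m" for u
  have bound: "\<forall>\<^sub>F u in nhds s. 0 \<le> h u \<and> h u \<le> q u"
    using ev
  proof eventually_elim
    case (elim u)
    then have cu: "c u \<in> M" "(c u)\<^sup>\<star> = c u" "\<And>y. y \<in> spec (c u) \<Longrightarrow> 0 < y" "t X = t (c u)"
      using X by (auto simp: pos_def_def pos_def_spec)
    show ?case
      using klein_inequality[OF X(1,3) cu(1,2,3) m cu(4)] cu X Z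
      by (simp add: h_def q_def T mem Z_def)
  qed
  have hs: "h s = 0" "q s = 0"
    using X Z T(1) by (simp_all add: h_def q_def T X_def[symmetric] Z_def[symmetric] mem linear_simps mm.zero_left)
  have dq: "(q has_real_derivative 0) (at s)"
  proof -
    have d: "((\<lambda>u. c u - X) has_vector_derivative v) (at s)"
      using has_vector_derivative_diff[OF c has_vector_derivative_const[of X]] by simp
    have "((\<lambda>u. (c u - X) ** (c u - X)) has_vector_derivative 0) (at s)"
      using mm.has_vector_derivative[OF d d] by (simp add: X_def)
    then have "((\<lambda>u. T ((c u - X) ** (c u - X))) has_vector_derivative T 0) (at s)"
      by (rule bounded_linear.has_vector_derivative[OF T(1)])
    then have "((\<lambda>u. T ((c u - X) ** (c u - X))) has_real_derivative 0) (at s)"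
      using T(1) by (simp add: has_real_derivative_iff_has_vector_derivative linear_simps)
    from DERIV_cdivide[OF this, of m] show ?thesis by (simp add: q_def[abs_def])
  qed
  have dh: "(h has_real_derivative 0) (at s)"
    unfolding has_field_derivative_iff hs
  proof (rule Lim_null_comparison)
    show "((\<lambda>y. norm ((q y - q s) / (y - s))) \<longlongrightarrow> 0) (at s)"
      using dq unfolding has_field_derivative_iff by (rule tendsto_norm_zero)
    show "\<forall>\<^sub>F y in at s. norm ((h y - 0) / (y - s)) \<le> norm ((q y - q s) / (y - s))"
      using eventually_nhds_conv_at[of _ s, THEN iffD1, OF bound, THEN conjunct1]
      by eventually_elim (auto simp: hs intro!: divide_right_mono)
  qed
  have "((\<lambda>u. c u ** Z) has_vector_derivative v ** Z) (at s)"
    using mm.has_vector_derivative[OF c has_vector_derivative_const[of Z]] by (simp add: mm.zero_right)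
  then have "((\<lambda>u. T (c u ** Z)) has_vector_derivative T (v ** Z)) (at s)"
    by (rule bounded_linear.has_vector_derivative[OF T(1)])
  then have "((\<lambda>u. T (c u ** Z)) has_real_derivative Re (t (v ** Z))) (at s)"
    using v Z by (simp add: has_real_derivative_iff_has_vector_derivative T mem)
  from DERIV_add[OF dh this] show ?thesis
    by (simp add: h_def Z_def X_def)
qed

end

section \<open>Differential structures with trivial invariant state\<close>

lemma unital_star_hom_dest:
  assumes "unital_star_hom M N h"
  shows "X \<in> M \<Longrightarrow> h X \<in> N" "h (mat 1) = mat 1" "X \<in> M \<Longrightarrow> Y \<in> M \<Longrightarrow> h (X + Y) = h X + h Y"
    "X \<in> M \<Longrightarrow> Y \<in> M \<Longrightarrow> h (X ** Y) = h X ** h Y" "X \<in> M \<Longrightarrow> h (r *\<^sub>R X) = r *\<^sub>R h X"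
    "X \<in> M \<Longrightarrow> h (X\<^sup>\<star>) = (h X)\<^sup>\<star>" "X \<in> M \<Longrightarrow> h (c *\<^sub>C X) = c *\<^sub>C h X"
  using assms unfolding unital_star_hom_def scaleR_eq_cscale by blast+

lemma unital_star_hom_diff:
  assumes h: "unital_star_hom M N h" and M: "vN_algebra M" and XY: "X \<in> M" "Y \<in> M"
  shows "h (X - Y) = h X - h Y"
  using unital_star_hom_dest(3)[OF h XY(1) vN_algebra_scaleR[OF M XY(2)], of "- 1"]
    unital_star_hom_dest(5)[OF h XY(2), of "- 1"] by simp

lemma unital_star_hom_sum:
  assumes h: "unital_star_hom M N h" and M: "vN_algebra M"
  shows "(\<And>i. i \<in> I \<Longrightarrow> f i \<in> M) \<Longrightarrow> h (\<Sum>i\<in>I. f i) = (\<Sum>i\<in>I. h (f i))"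
proof (induction I rule: infinite_finite_induct)
  case (insert i I)
  then show ?case using M by (simp add: unital_star_hom_dest(3)[OF h] vN_algebra_sum)
qed (use unital_star_hom_diff[OF h M, of "mat 1" "mat 1"] M in \<open>simp_all add: vN_algebra_closed\<close>)

locale tracial_structure =
  fixes S :: "('n::finite, 'm::finite, 'j) diff_data"
  assumes diff_structure: "differential_structure S" and sig_1: "sig S = mat 1"
begin

sublocale A: tracial_algebra "Alg S" "tr S"
  by standard (use diff_structure in \<open>auto simp: differential_structure_def\<close>)

lemma
  assumes "j \<in> Idx S"
  shows BAlg: "tracial_algebra (BAlg S j) (trB S j)"
    and lhom: "unital_star_hom (Alg S) (BAlg S j) (lhom S j)"
    and rhom: "unital_star_hom (Alg S) (BAlg S j) (rhom S j)"
    and Vel: "Vel S j \<in> BAlg S j" "Vel S j \<noteq> 0"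
  using diff_structure assms unfolding differential_structure_def tracial_algebra_def by blast+

text \<open>For \<sigma> = 1 the eigenvector relation of the structure reads
  \<open>Vel S j = exp (- freq S j) *\<^sub>R Vel S j\<close>, and \<open>Vel S j\<close> is
  nonzero.\<close>

lemma freq_0:
  assumes j: "j \<in> Idx S"
  shows "freq S j = 0"
proof -
  have inv: "matrix_inv (mat 1 :: 'm cmat) = mat 1"
  proof -
    have "\<exists>A :: 'm cmat. mat 1 ** A = mat 1 \<and> A ** mat 1 = mat 1" by (rule exI[of _ "mat 1"]) simp
    from someI_ex[OF this] show ?thesis by (simp add: matrix_inv_def)
  qed
  have "lhom S j (sig S) ** Vel S j ** matrix_inv (rhom S j (sig S)) = exp (- freq S j) *\<^sub>R Vel S j"
    using diff_structure j unfolding differential_structure_def by blast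
  then have "(exp (- freq S j) - 1) *\<^sub>R Vel S j = 0"
    using j by (simp add: sig_1 unital_star_hom_dest(2)[OF lhom] unital_star_hom_dest(2)[OF rhom] inv
        scaleR_diff_left)
  with Vel(2)[OF j] show ?thesis by simp
qed

lemma theta_eq_log_mean: "j \<in> Idx S \<Longrightarrow> theta S j = log_mean"
  by (simp add: theta_def fun_eq_iff freq_0)

section \<open>Derivations, their adjoints and the energy form\<close>

lemma pd_mem: "j \<in> Idx S \<Longrightarrow> A \<in> Alg S \<Longrightarrow> pd S j A \<in> BAlg S j"
  using tracial_algebra.mem[OF BAlg] Vel(1) unital_star_hom_dest(1)[OF lhom] unital_star_hom_dest(1)[OF rhom]
  by (simp add: pd_def)

lemma pd_add: "j \<in> Idx S \<Longrightarrow> A \<in> Alg S \<Longrightarrow> B \<in> Alg S \<Longrightarrow> pd S j (A + B) = pd S j A + pd S j B"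
  by (simp add: pd_def unital_star_hom_dest(3)[OF lhom] unital_star_hom_dest(3)[OF rhom] cmat_mult_distribs)

lemma pd_scaleR: "j \<in> Idx S \<Longrightarrow> A \<in> Alg S \<Longrightarrow> pd S j (r *\<^sub>R A) = r *\<^sub>R pd S j A"
  by (simp add: pd_def unital_star_hom_dest(5)[OF lhom] unital_star_hom_dest(5)[OF rhom]
      cmat_mult_scaleR scaleR_diff_right)

lemma pd_cscale: "j \<in> Idx S \<Longrightarrow> A \<in> Alg S \<Longrightarrow> pd S j (c *\<^sub>C A) = c *\<^sub>C pd S j A"
  by (simp add: pd_def unital_star_hom_dest(7)[OF lhom] unital_star_hom_dest(7)[OF rhom]
      cmat_mult_cscale) (simp add: cscale_def vec_eq_iff right_diff_distrib)

lemma pd_mat_1: "j \<in> Idx S \<Longrightarrow> pd S j (mat 1) = 0"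
  by (simp add: pd_def unital_star_hom_dest(2)[OF lhom] unital_star_hom_dest(2)[OF rhom])

text \<open>Existence comes from representing an antilinear functional, uniqueness from faithfulness
  of the trace; together they justify the definite description.\<close>

lemma pd_dagger:
  assumes j: "j \<in> Idx S" and X: "X \<in> BAlg S j"
  shows "pd_dagger S j X \<in> Alg S"
    and "A \<in> Alg S \<Longrightarrow> tr S (A\<^sup>\<star> ** pd_dagger S j X) = trB S j ((pd S j A)\<^sup>\<star> ** X)"
proof -
  interpret B: tracial_algebra "BAlg S j" "trB S j" using BAlg[OF j] .
  have "(c *\<^sub>C Y)\<^sup>\<star> = cnj c *\<^sub>C Y\<^sup>\<star>" for c and Y :: "'m cmat"
    by (simp add: cscale_def adj_def vec_eq_iff)
  then obtain Y where Y: "Y \<in> Alg S"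
    "\<And>A. A \<in> Alg S \<Longrightarrow> tr S (A\<^sup>\<star> ** Y) = trB S j ((pd S j A)\<^sup>\<star> ** X)"
    using A.antilinear_representation[of "\<lambda>A. trB S j ((pd S j A)\<^sup>\<star> ** X)"] j X
    by (auto simp: pd_add pd_cscale adj_add cmat_mult_distribs cmat_mult_cscale B.trace_add B.trace_cscale B.mem pd_mem)
  let ?P = "\<lambda>Y. Y \<in> Alg S \<and> (\<forall>A\<in>Alg S. tr S (A\<^sup>\<star> ** Y) = trB S j ((pd S j A)\<^sup>\<star> ** X))"
  have "?P (pd_dagger S j X)"
    unfolding pd_dagger_def
  proof (rule theI)
    show "?P Y" using Y by blast
    show "Z = Y" if "?P Z" for Z using that Y by (intro A.eq_by_trace) auto
  qed
  then show "pd_dagger S j X \<in> Alg S"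
    "A \<in> Alg S \<Longrightarrow> tr S (A\<^sup>\<star> ** pd_dagger S j X) = trB S j ((pd S j A)\<^sup>\<star> ** X)" by blast+
qed

text \<open>One spectral block of the metric tensor, antilinear in \<open>B\<close> and linear in
  \<open>A\<close>. Separating blocks from weights lets the energy at \<rho>, the energy at
  perturbed states and the Dirichlet form share the same blocks.\<close>

definition grad_form :: "'j \<Rightarrow> 'n cmat \<Rightarrow> 'n cmat \<Rightarrow> 'n cmat \<Rightarrow> 'n cmat \<Rightarrow> complex" where
  "grad_form j P Q B A = trB S j ((pd S j B)\<^sup>\<star> ** (lhom S j P ** pd S j A ** rhom S j Q))"

text \<open>The pairing of \<open>B\<close> with \<open>Kop S \<rho> A\<close> in explicit form; the
  weights are plain logarithmic means because all frequencies vanish.\<close>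

definition energy :: "'n cmat \<Rightarrow> 'n cmat \<Rightarrow> 'n cmat \<Rightarrow> complex" where
  "energy \<rho> B A = (\<Sum>j\<in>Idx S. \<Sum>\<mu>\<in>spec \<rho>. \<Sum>\<nu>\<in>spec \<rho>.
     of_real (log_mean \<mu> \<nu>) * grad_form j (sproj \<rho> \<mu>) (sproj \<rho> \<nu>) B A)"

lemma Kop_energy:
  assumes \<rho>: "\<rho> \<in> Alg S" "\<rho>\<^sup>\<star> = \<rho>" and A: "A \<in> Alg S"
  shows "Kop S \<rho> A \<in> Alg S" and "B \<in> Alg S \<Longrightarrow> tr S (B\<^sup>\<star> ** Kop S \<rho> A) = energy \<rho> B A"
proof -
  have P: "sproj \<rho> \<mu> \<in> Alg S" for \<mu> using \<rho> by (simp add: sproj_in_algebra A.vN)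
  have term_mem: "lhom S j (sproj \<rho> \<mu>) ** pd S j A ** rhom S j (sproj \<rho> \<nu>) \<in> BAlg S j" if "j \<in> Idx S" for j \<mu> \<nu>
    using tracial_algebra.mem[OF BAlg[OF that]] that P A unital_star_hom_dest(1)[OF lhom]
      unital_star_hom_dest(1)[OF rhom] pd_mem by simp
  have hat: "rho_hat S j \<rho> (pd S j A) \<in> BAlg S j" if "j \<in> Idx S" for j
    unfolding rho_hat_def by (intro tracial_algebra.mem[OF BAlg[OF that]] term_mem that)
  show "Kop S \<rho> A \<in> Alg S"
    unfolding Kop_def by (intro A.mem pd_dagger hat)
  assume B: "B \<in> Alg S"
  have "tr S (B\<^sup>\<star> ** Kop S \<rho> A) = (\<Sum>j\<in>Idx S. trB S j ((pd S j B)\<^sup>\<star> ** rho_hat S j \<rho> (pd S j A)))"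
    using B hat by (simp add: Kop_def cmat_mult_sum A.trace_sum A.mem pd_dagger)
  also have "\<dots> = energy \<rho> B A"
    unfolding energy_def
  proof (rule sum.cong)
    fix j assume j: "j \<in> Idx S"
    interpret B: tracial_algebra "BAlg S j" "trB S j" using BAlg[OF j] .
    have adj: "(pd S j B)\<^sup>\<star> \<in> BAlg S j" using j B by (simp add: B.mem pd_mem)
    show "trB S j ((pd S j B)\<^sup>\<star> ** rho_hat S j \<rho> (pd S j A)) = (\<Sum>\<mu>\<in>spec \<rho>. \<Sum>\<nu>\<in>spec \<rho>.
        of_real (log_mean \<mu> \<nu>) * grad_form j (sproj \<rho> \<mu>) (sproj \<rho> \<nu>) B A)"
      using adj term_mem[OF j]
      by (simp add: rho_hat_def cmat_mult_sum cmat_mult_scaleR B.trace_sum B.trace_scaleR B.mem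
          grad_form_def theta_eq_log_mean j)
  qed simp
  finally show "tr S (B\<^sup>\<star> ** Kop S \<rho> A) = energy \<rho> B A" .
qed

lemma
  assumes j: "j \<in> Idx S" and "P \<in> Alg S" "Q \<in> Alg S" "B \<in> Alg S"
  shows grad_form_add: "A \<in> Alg S \<Longrightarrow> A' \<in> Alg S \<Longrightarrow>
      grad_form j P Q B (A + A') = grad_form j P Q B A + grad_form j P Q B A'"
    and grad_form_scaleR: "A \<in> Alg S \<Longrightarrow> grad_form j P Q B (r *\<^sub>R A) = of_real r * grad_form j P Q B A"
proof -
  interpret B: tracial_algebra "BAlg S j" "trB S j" using BAlg[OF j] .
  note mems = assms B.mem pd_mem unital_star_hom_dest(1)[OF lhom] unital_star_hom_dest(1)[OF rhom]
  show "A \<in> Alg S \<Longrightarrow> A' \<in> Alg S \<Longrightarrow>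
      grad_form j P Q B (A + A') = grad_form j P Q B A + grad_form j P Q B A'"
    by (simp add: grad_form_def pd_add cmat_mult_distribs B.trace_add mems)
  show "A \<in> Alg S \<Longrightarrow> grad_form j P Q B (r *\<^sub>R A) = of_real r * grad_form j P Q B A"
    by (simp add: grad_form_def pd_scaleR cmat_mult_scaleR B.trace_scaleR mems)
qed

lemma grad_form_hermitian:
  assumes j: "j \<in> Idx S" and "P \<in> Alg S" "Q \<in> Alg S" "A \<in> Alg S" "B \<in> Alg S" "P\<^sup>\<star> = P" "Q\<^sup>\<star> = Q"
  shows "cnj (grad_form j P Q B A) = grad_form j P Q A B"
proof -
  interpret B: tracial_algebra "BAlg S j" "trB S j" using BAlg[OF j] .
  note mems = assms B.mem pd_mem unital_star_hom_dest(1)[OF lhom] unital_star_hom_dest(1)[OF rhom]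
  let ?l = "lhom S j P" and ?r = "rhom S j Q"
  have lr: "?l\<^sup>\<star> = ?l" "?r\<^sup>\<star> = ?r"
    using assms unital_star_hom_dest(6)[OF lhom, of j P] unital_star_hom_dest(6)[OF rhom, of j Q] by simp_all
  have "cnj (grad_form j P Q B A) = trB S j (((pd S j B)\<^sup>\<star> ** (?l ** pd S j A ** ?r))\<^sup>\<star>)"
    unfolding grad_form_def by (rule B.trace_adj[symmetric]) (simp add: mems)
  also have "\<dots> = trB S j (?r ** ((pd S j A)\<^sup>\<star> ** ?l ** pd S j B))"
    by (simp add: adj_mult lr matrix_mul_assoc)
  also have "\<dots> = trB S j ((pd S j A)\<^sup>\<star> ** ?l ** pd S j B ** ?r)"
    by (rule B.trace_comm) (simp_all add: mems)
  finally show ?thesis by (simp add: grad_form_def matrix_mul_assoc)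
qed

text \<open>By cyclicity and idempotence the block is the trace of
  \<open>X\<^sup>\<star> ** X\<close> with
  \<open>X = lhom S j P ** pd S j A ** rhom S j Q\<close>.\<close>

lemma grad_form_nonneg:
  assumes j: "j \<in> Idx S" and "P \<in> Alg S" "Q \<in> Alg S" "A \<in> Alg S" "P\<^sup>\<star> = P" "Q\<^sup>\<star> = Q" "P ** P = P" "Q ** Q = Q"
  shows "0 \<le> Re (grad_form j P Q A A)"
proof -
  interpret B: tracial_algebra "BAlg S j" "trB S j" using BAlg[OF j] .
  note mems = assms B.mem pd_mem unital_star_hom_dest(1)[OF lhom] unital_star_hom_dest(1)[OF rhom]
  let ?l = "lhom S j P" and ?r = "rhom S j Q"
  have lr: "?l\<^sup>\<star> = ?l" "?r\<^sup>\<star> = ?r" "?l ** ?l = ?l" "?r ** ?r = ?r"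
    using assms unital_star_hom_dest(6)[OF lhom, of j P] unital_star_hom_dest(6)[OF rhom, of j Q]
      unital_star_hom_dest(4)[OF lhom, of j P P] unital_star_hom_dest(4)[OF rhom, of j Q Q] by simp_all
  have "(?l ** pd S j A ** ?r)\<^sup>\<star> ** (?l ** pd S j A ** ?r) = ?r ** ((pd S j A)\<^sup>\<star> ** (?l ** ?l) ** pd S j A ** ?r)"
    by (simp only: adj_mult lr(1,2) matrix_mul_assoc)
  moreover have "trB S j (?r ** ((pd S j A)\<^sup>\<star> ** (?l ** ?l) ** pd S j A ** ?r)) =
      trB S j ((pd S j A)\<^sup>\<star> ** (?l ** ?l) ** pd S j A ** ?r ** ?r)"
    by (rule B.trace_comm) (simp_all add: mems)
  moreover have "(pd S j A)\<^sup>\<star> ** (?l ** ?l) ** pd S j A ** ?r ** ?r = (pd S j A)\<^sup>\<star> ** (?l ** pd S j A ** ?r)"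
    using lr(3,4) by (metis matrix_mul_assoc)
  ultimately have "grad_form j P Q A A =
      trB S j ((?l ** pd S j A ** ?r)\<^sup>\<star> ** (?l ** pd S j A ** ?r))"
    by (simp add: grad_form_def)
  then show ?thesis
    using B.trace_nonneg[of "?l ** pd S j A ** ?r"] by (simp add: mems)
qed

text \<open>The expression that the exchange axiom for adjoint indices speaks about. Each
  \<open>grad_form\<close> is a combination of four of these, which is how the axiom reaches the
  energy.\<close>

definition corr :: "'j \<Rightarrow> 'n cmat \<Rightarrow> 'n cmat \<Rightarrow> complex" where
  "corr j X Y = trB S j ((Vel S j)\<^sup>\<star> ** lhom S j X ** Vel S j ** rhom S j Y)"

lemma grad_form_corr:
  assumes j: "j \<in> Idx S" and "P \<in> Alg S" "Q \<in> Alg S" "A \<in> Alg S" "B \<in> Alg S"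
  shows "grad_form j P Q B A = corr j P (A ** Q ** B\<^sup>\<star>) - corr j (P ** A) (Q ** B\<^sup>\<star>)
    - corr j (B\<^sup>\<star> ** P) (A ** Q) + corr j (B\<^sup>\<star> ** P ** A) Q"
proof -
  interpret B: tracial_algebra "BAlg S j" "trB S j" using BAlg[OF j] .
  note mems = assms B.mem A.mem pd_mem Vel(1) unital_star_hom_dest(1)[OF lhom] unital_star_hom_dest(1)[OF rhom]
  let ?V = "Vel S j" and ?l = "lhom S j" and ?r = "rhom S j"
  note mult = unital_star_hom_dest(4)[OF lhom[OF j]] unital_star_hom_dest(4)[OF rhom[OF j]]
  have adj: "(pd S j B)\<^sup>\<star> = ?r (B\<^sup>\<star>) ** ?V\<^sup>\<star> - ?V\<^sup>\<star> ** ?l (B\<^sup>\<star>)"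
    using assms by (simp add: pd_def adj_diff adj_mult unital_star_hom_dest(6)[OF lhom] unital_star_hom_dest(6)[OF rhom])
  have "trB S j (?r (B\<^sup>\<star>) ** (?V\<^sup>\<star> ** ?l P ** ?V ** ?r A ** ?r Q)) =
      trB S j (?V\<^sup>\<star> ** ?l P ** ?V ** ?r A ** ?r Q ** ?r (B\<^sup>\<star>))"
    by (rule B.trace_comm) (simp_all add: mems)
  moreover have "trB S j (?r (B\<^sup>\<star>) ** (?V\<^sup>\<star> ** ?l P ** ?l A ** ?V ** ?r Q)) =
      trB S j (?V\<^sup>\<star> ** ?l P ** ?l A ** ?V ** ?r Q ** ?r (B\<^sup>\<star>))"
    by (rule B.trace_comm) (simp_all add: mems)
  ultimately show ?thesis
    unfolding grad_form_def adj corr_def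
    by (simp add: pd_def cmat_mult_distribs B.trace_diff mems mult matrix_mul_assoc)
qed

lemma corr_cnj:
  assumes j: "j \<in> Idx S" and "X \<in> Alg S" "Y \<in> Alg S"
  shows "cnj (corr j X Y) = corr j (X\<^sup>\<star>) (Y\<^sup>\<star>)"
proof -
  interpret B: tracial_algebra "BAlg S j" "trB S j" using BAlg[OF j] .
  note mems = assms B.mem A.mem Vel(1) unital_star_hom_dest(1)[OF lhom] unital_star_hom_dest(1)[OF rhom]
  let ?V = "Vel S j" and ?l = "lhom S j" and ?r = "rhom S j"
  have "cnj (corr j X Y) = trB S j ((?V\<^sup>\<star> ** ?l X ** ?V ** ?r Y)\<^sup>\<star>)"
    unfolding corr_def by (rule B.trace_adj[symmetric]) (simp add: mems)
  also have "\<dots> = trB S j (?r (Y\<^sup>\<star>) ** (?V\<^sup>\<star> ** ?l (X\<^sup>\<star>) ** ?V))"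
    using assms by (simp add: adj_mult unital_star_hom_dest(6)[OF lhom] unital_star_hom_dest(6)[OF rhom] matrix_mul_assoc)
  also have "\<dots> = trB S j (?V\<^sup>\<star> ** ?l (X\<^sup>\<star>) ** ?V ** ?r (Y\<^sup>\<star>))"
    by (rule B.trace_comm) (simp_all add: mems)
  finally show ?thesis by (simp add: corr_def)
qed

text \<open>The exchange axiom followed by one cyclic rotation: as \<open>Vel S k\<close> is the
  adjoint of \<open>Vel S j\<close>, the rotated trace is a correlation for \<open>k\<close> with
  its arguments swapped.\<close>

lemma corr_adjoint_index:
  assumes j: "j \<in> Idx S" and k: "k \<in> Idx S" and jk: "adjoint_index S j k"
    and "X \<in> Alg S" "Y \<in> Alg S"
  shows "corr j X Y = corr k Y X"
proof -
  interpret B: tracial_algebra "BAlg S j" "trB S j" using BAlg[OF j] .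
  have Bk: "BAlg S k = BAlg S j" "Vel S k = (Vel S j)\<^sup>\<star>" "\<And>X. X \<in> BAlg S j \<Longrightarrow> trB S k X = trB S j X"
    using jk by (auto simp: adjoint_index_def)
  have homk: "X \<in> Alg S \<Longrightarrow> lhom S k X \<in> BAlg S j" "X \<in> Alg S \<Longrightarrow> rhom S k X \<in> BAlg S j" for X
    using unital_star_hom_dest(1)[OF lhom[OF k]] unital_star_hom_dest(1)[OF rhom[OF k]] Bk by auto
  note mems = assms B.mem Vel(1) homk
  have "corr j X Y = trB S j ((Vel S j)\<^sup>\<star> ** rhom S k X ** (Vel S j ** lhom S k Y))"
  proof -
    have "\<forall>j\<in>Idx S. \<forall>k\<in>Idx S. adjoint_index S j k \<longrightarrow> (\<forall>X\<in>Alg S. \<forall>Y\<in>Alg S.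
        trB S j ((Vel S j)\<^sup>\<star> ** lhom S j X ** Vel S j ** rhom S j Y) =
        trB S j ((Vel S j)\<^sup>\<star> ** rhom S k X ** Vel S j ** lhom S k Y))"
      using diff_structure unfolding differential_structure_def by blast
    with assms show ?thesis by (simp add: corr_def matrix_mul_assoc)
  qed
  also have "\<dots> = trB S j (Vel S j ** lhom S k Y ** ((Vel S j)\<^sup>\<star> ** rhom S k X))"
    by (rule B.trace_comm) (simp_all add: mems)
  also have "\<dots> = corr k Y X"
    using Bk by (simp add: corr_def matrix_mul_assoc mems)
  finally show ?thesis .
qed

text \<open>The pairing of \<open>j\<close> with \<open>j\<^sup>*\<close> exchanges left and right; summed over all \<open>j\<close> this makes
  \<open>Kop S \<rho>\<close> preserve self-adjointness.\<close>

lemma grad_form_adjoint_index: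
  assumes jk: "j \<in> Idx S" "k \<in> Idx S" "adjoint_index S j k"
    and mems: "P \<in> Alg S" "Q \<in> Alg S" "A \<in> Alg S" "B \<in> Alg S"
    and adj: "P\<^sup>\<star> = P" "Q\<^sup>\<star> = Q" "A\<^sup>\<star> = A"
  shows "cnj (grad_form j P Q (B\<^sup>\<star>) A) = grad_form k Q P B A"
  using mems
  by (simp add: grad_form_corr jk(1,2) A.mem corr_cnj adj adj_mult corr_adjoint_index[OF jk] matrix_mul_assoc)

definition star_index :: "'j \<Rightarrow> 'j" where
  "star_index j = (THE k. k \<in> Idx S \<and> adjoint_index S j k)"

lemma star_index:
  assumes "j \<in> Idx S"
  shows "star_index j \<in> Idx S" "adjoint_index S j (star_index j)"
proof -
  have "\<exists>!k. k \<in> Idx S \<and> adjoint_index S j k"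
    using diff_structure assms unfolding differential_structure_def by blast
  from theI'[OF this] show "star_index j \<in> Idx S" "adjoint_index S j (star_index j)"
    by (simp_all add: star_index_def)
qed

text \<open>The relation \<open>adjoint_index\<close> is symmetric, so uniqueness of the partner of
  \<open>star_index j\<close> identifies it with \<open>j\<close>.\<close>

lemma star_index_involution: 
  assumes "j \<in> Idx S"
  shows "star_index (star_index j) = j"
proof -
  have "adjoint_index S (star_index j) j"
    using star_index(2)[OF assms] by (simp add: adjoint_index_def)
  moreover have "\<exists>!k. k \<in> Idx S \<and> adjoint_index S (star_index j) k"
    using diff_structure star_index(1)[OF assms] unfolding differential_structure_def by blast
  ultimately show ?thesis
    using star_index[OF star_index(1)[OF assms]] assms by blast
qed

lemma bij_star_index: "bij_betw star_index (Idx S) (Idx S)"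
  by (rule bij_betwI[where g = star_index]) (auto simp: star_index star_index_involution)

lemma energy_hermitian:
  assumes \<rho>: "\<rho> \<in> Alg S" "\<rho>\<^sup>\<star> = \<rho>" and AB: "A \<in> Alg S" "B \<in> Alg S"
  shows "cnj (energy \<rho> B A) = energy \<rho> A B"
  using assms by (simp add: energy_def grad_form_hermitian sproj_in_algebra A.vN adj_sproj)

text \<open>Conjugation replaces \<open>j\<close> by \<open>star_index j\<close> and swaps the two
  projections. Summing over all indices and both eigenvalues undoes this, since the logarithmic mean
  is symmetric.\<close>

lemma energy_real:
  assumes \<rho>: "\<rho> \<in> Alg S" "\<rho>\<^sup>\<star> = \<rho>" and AB: "A \<in> Alg S" "B \<in> Alg S" and A: "A\<^sup>\<star> = A"
  shows "cnj (energy \<rho> (B\<^sup>\<star>) A) = energy \<rho> B A"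
proof -
  have P: "sproj \<rho> \<mu> \<in> Alg S" "(sproj \<rho> \<mu>)\<^sup>\<star> = sproj \<rho> \<mu>" for \<mu>
    using \<rho> by (simp_all add: sproj_in_algebra A.vN adj_sproj)
  let ?f = "\<lambda>j \<mu> \<nu>. of_real (log_mean \<mu> \<nu>) * grad_form j (sproj \<rho> \<mu>) (sproj \<rho> \<nu>) B A"
  have "cnj (energy \<rho> (B\<^sup>\<star>) A) = (\<Sum>j\<in>Idx S. \<Sum>\<mu>\<in>spec \<rho>. \<Sum>\<nu>\<in>spec \<rho>. ?f (star_index j) \<nu> \<mu>)"
    unfolding energy_def cnj_sum complex_cnj_mult
    by (intro sum.cong refl)
      (simp add: grad_form_adjoint_index[OF _ star_index] P AB A log_mean_commute)
  also have "\<dots> = (\<Sum>j\<in>Idx S. \<Sum>\<mu>\<in>spec \<rho>. \<Sum>\<nu>\<in>spec \<rho>. ?f j \<nu> \<mu>)"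
    by (rule sum.reindex_bij_betw[OF bij_star_index, of "\<lambda>j. \<Sum>\<mu>\<in>spec \<rho>. \<Sum>\<nu>\<in>spec \<rho>. ?f j \<nu> \<mu>"])
  also have "\<dots> = energy \<rho> B A"
    unfolding energy_def by (rule sum.cong[OF refl], rule sum.swap)
  finally show ?thesis .
qed

lemma
  assumes \<rho>: "\<rho> \<in> Alg S" "\<rho>\<^sup>\<star> = \<rho>"
  shows Kop_add: "A \<in> Alg S \<Longrightarrow> A' \<in> Alg S \<Longrightarrow> Kop S \<rho> (A + A') = Kop S \<rho> A + Kop S \<rho> A'"
    and Kop_scaleR: "A \<in> Alg S \<Longrightarrow> Kop S \<rho> (r *\<^sub>R A) = r *\<^sub>R Kop S \<rho> A"
proof -
  note simps = Kop_energy[OF \<rho>] A.mem cmat_mult_distribs cmat_mult_scaleR A.trace_add A.trace_scaleR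
    energy_def grad_form_add grad_form_scaleR sproj_in_algebra \<rho> A.vN
  show "A \<in> Alg S \<Longrightarrow> A' \<in> Alg S \<Longrightarrow> Kop S \<rho> (A + A') = Kop S \<rho> A + Kop S \<rho> A'"
    by (rule A.eq_by_trace) (simp_all add: simps ring_distribs sum.distrib)
  show "A \<in> Alg S \<Longrightarrow> Kop S \<rho> (r *\<^sub>R A) = r *\<^sub>R Kop S \<rho> A"
    by (rule A.eq_by_trace) (simp_all add: simps sum_distrib_left mult_ac)
qed

section \<open>The operator \<open>Kop S \<rho>\<close> on the tangent space\<close>

lemma subspace_tangent: "subspace (tangent S)"
  by (auto simp: subspace_def tangent_def A.mem A.trace_0 A.trace_add A.trace_scaleR adj_add adj_scaleR)

text \<open>The trace vanishes because it is a pairing with \<open>mat 1\<close>, which every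
  \<open>pd S j\<close> kills; self-adjointness is \<open>energy_real\<close> read through the trace
  pairing.\<close>

lemma Kop_tangent:
  assumes \<rho>: "\<rho> \<in> Alg S" "\<rho>\<^sup>\<star> = \<rho>" and A: "A \<in> tangent S"
  shows "Kop S \<rho> A \<in> tangent S"
proof -
  have A': "A \<in> Alg S" "A\<^sup>\<star> = A" using A by (auto simp: tangent_def)
  note K = Kop_energy[OF \<rho> A'(1)]
  have "tr S (Kop S \<rho> A) = 0"
    using K(2)[of "mat 1"] A.trace_0 tracial_algebra.trace_0[OF BAlg]
    by (simp add: A.mem energy_def grad_form_def pd_mat_1)
  moreover have "(Kop S \<rho> A)\<^sup>\<star> = Kop S \<rho> A"
  proof (rule A.eq_by_trace)
    fix X assume X: "X \<in> Alg S"
    have "tr S (X\<^sup>\<star> ** (Kop S \<rho> A)\<^sup>\<star>) = cnj (tr S (Kop S \<rho> A ** X))"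
      using A.trace_adj[of "Kop S \<rho> A ** X"] X K(1) by (simp add: adj_mult A.mem)
    also have "\<dots> = cnj (tr S ((X\<^sup>\<star>)\<^sup>\<star> ** Kop S \<rho> A))"
      using A.trace_comm[of "Kop S \<rho> A" X] X K(1) by simp
    also have "\<dots> = tr S (X\<^sup>\<star> ** Kop S \<rho> A)"
      using X K(2)[of "X\<^sup>\<star>"] K(2)[of X] by (simp add: A.mem energy_real[OF \<rho> A'(1) _ A'(2)])
    finally show "tr S (X\<^sup>\<star> ** (Kop S \<rho> A)\<^sup>\<star>) = tr S (X\<^sup>\<star> ** Kop S \<rho> A)" .
  qed (use K in \<open>simp_all add: A.mem\<close>)
  ultimately show ?thesis using K(1) by (simp add: tangent_def)
qed

lemma Kop_symmetric:
  assumes \<rho>: "\<rho> \<in> Alg S" "\<rho>\<^sup>\<star> = \<rho>" and A: "A \<in> tangent S" and B: "B \<in> tangent S"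
  shows "Re (tr S (A ** Kop S \<rho> B)) = Re (tr S (B ** Kop S \<rho> A))"
proof -
  have AB: "A \<in> Alg S" "B \<in> Alg S" "A\<^sup>\<star> = A" "B\<^sup>\<star> = B" using A B by (auto simp: tangent_def)
  have "cnj (tr S (B ** Kop S \<rho> A)) = tr S (A ** Kop S \<rho> B)"
    using Kop_energy(2)[OF \<rho> AB(1,2)] Kop_energy(2)[OF \<rho> AB(2,1)] energy_hermitian[OF \<rho> AB(1,2)] AB by simp
  then show ?thesis by (metis cnj.simps(1))
qed

text \<open>With all weights equal to 1 the projections sum to the identity and the energy collapses
  to a Dirichlet form. This links \<open>Kop S \<rho>\<close> to the generator.\<close>

lemma sum_grad_form_sproj:
  assumes \<rho>: "\<rho> \<in> Alg S" "\<rho>\<^sup>\<star> = \<rho>" and j: "j \<in> Idx S" and AB: "A \<in> Alg S" "B \<in> Alg S"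
  shows "(\<Sum>\<mu>\<in>spec \<rho>. \<Sum>\<nu>\<in>spec \<rho>. grad_form j (sproj \<rho> \<mu>) (sproj \<rho> \<nu>) B A) =
    trB S j ((pd S j B)\<^sup>\<star> ** pd S j A)"
proof -
  interpret B: tracial_algebra "BAlg S j" "trB S j" using BAlg[OF j] .
  have P: "sproj \<rho> \<mu> \<in> Alg S" for \<mu> using \<rho> by (simp add: sproj_in_algebra A.vN)
  note mems = assms P B.mem pd_mem unital_star_hom_dest(1)[OF lhom] unital_star_hom_dest(1)[OF rhom]
  have one: "(\<Sum>\<mu>\<in>spec \<rho>. lhom S j (sproj \<rho> \<mu>)) = mat 1" "(\<Sum>\<mu>\<in>spec \<rho>. rhom S j (sproj \<rho> \<mu>)) = mat 1"
    using unital_star_hom_sum[OF lhom[OF j] A.vN, of "spec \<rho>" "sproj \<rho>"]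
      unital_star_hom_sum[OF rhom[OF j] A.vN, of "spec \<rho>" "sproj \<rho>"] P sum_sproj[OF \<rho>(2)]
      unital_star_hom_dest(2)[OF lhom[OF j]] unital_star_hom_dest(2)[OF rhom[OF j]] by simp_all
  have "(pd S j B)\<^sup>\<star> ** pd S j A =
    (pd S j B)\<^sup>\<star> ** ((\<Sum>\<mu>\<in>spec \<rho>. lhom S j (sproj \<rho> \<mu>)) ** pd S j A ** (\<Sum>\<nu>\<in>spec \<rho>. rhom S j (sproj \<rho> \<nu>)))"
    by (simp add: one)
  also have "\<dots> = (\<Sum>\<mu>\<in>spec \<rho>. \<Sum>\<nu>\<in>spec \<rho>.
      (pd S j B)\<^sup>\<star> ** (lhom S j (sproj \<rho> \<mu>) ** pd S j A ** rhom S j (sproj \<rho> \<nu>)))"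
    by (simp only: cmat_mult_sum) (rule sum.swap)
  finally show ?thesis by (simp add: grad_form_def B.trace_sum mems)
qed

end

section \<open>The depolarizing channel\<close>

locale depolarizing_structure = tracial_structure S
  for S :: "('n::finite, 'm::finite, 'j) diff_data" +
  fixes L :: "'n cmat \<Rightarrow> 'n cmat" and \<gamma> :: real
  assumes \<gamma>_pos: "0 < \<gamma>" and trace_1: "tr S (mat 1) = 1" and generator: "is_generator S L"
    and depolarizing: "\<forall>A\<in>Alg S. L A = \<gamma> *\<^sub>R (tr S A *\<^sub>C mat 1 - A)"
begin

text \<open>The point where the depolarizing generator enters: the Dirichlet form is \<gamma> times
  the covariance, for every structure with this generator.\<close>

lemma dirichlet_form:
  assumes "A \<in> Alg S" "B \<in> Alg S"
  shows "(\<Sum>j\<in>Idx S. trB S j ((pd S j B)\<^sup>\<star> ** pd S j A)) =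
    of_real \<gamma> * (tr S (B\<^sup>\<star> ** A) - tr S A * tr S (B\<^sup>\<star>))"
proof -
  have sqrt: "fun_calc sqrt (sig S) = mat 1" by (simp add: sig_1 fun_calc_mat_1)
  have "(\<Sum>j\<in>Idx S. trB S j ((pd S j B)\<^sup>\<star> ** lhom S j (mat 1) ** pd S j A ** rhom S j (mat 1))) =
      - tr S (B\<^sup>\<star> ** mat 1 ** L A ** mat 1)"
    using generator assms unfolding is_generator_def sqrt by blast
  then have "(\<Sum>j\<in>Idx S. trB S j ((pd S j B)\<^sup>\<star> ** pd S j A)) = - tr S (B\<^sup>\<star> ** L A)"
    by (simp add: unital_star_hom_dest(2)[OF lhom] unital_star_hom_dest(2)[OF rhom])
  also have "\<dots> = of_real \<gamma> * (tr S (B\<^sup>\<star> ** A) - tr S A * tr S (B\<^sup>\<star>))"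
    using assms
    by (simp add: depolarizing[rule_format] cmat_mult_distribs cmat_mult_scaleR cmat_mult_cscale A.trace_scaleR
        A.trace_cscale A.trace_diff A.mem right_diff_distrib)
  finally show ?thesis .
qed

lemma states_posD:
  assumes "\<rho> \<in> states_pos S"
  shows "\<rho> \<in> Alg S" "\<rho>\<^sup>\<star> = \<rho>" "pos_def \<rho>" "tr S \<rho> = 1"
  using assms by (auto simp: states_pos_def pos_def_def)

lemma tangentD:
  assumes "A \<in> tangent S"
  shows "A \<in> Alg S" "A\<^sup>\<star> = A" "tr S A = 0"
  using assms by (auto simp: tangent_def)

lemma sproj_state:
  assumes "\<rho> \<in> states_pos S"
  shows "sproj \<rho> \<mu> \<in> Alg S" "(sproj \<rho> \<mu>)\<^sup>\<star> = sproj \<rho> \<mu>" "sproj \<rho> \<mu> ** sproj \<rho> \<mu> = sproj \<rho> \<mu>"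
  using states_posD[OF assms] by (simp_all add: sproj_in_algebra A.vN adj_sproj sproj_mult)

lemma grad_form_sproj_nonneg:
  assumes "\<rho> \<in> states_pos S" "j \<in> Idx S" "A \<in> Alg S"
  shows "0 \<le> Re (grad_form j (sproj \<rho> \<mu>) (sproj \<rho> \<nu>) A A)"
  using assms by (intro grad_form_nonneg sproj_state)

lemma trace_Kop:
  assumes "\<rho> \<in> states_pos S" "A \<in> tangent S"
  shows "Re (tr S (A ** Kop S \<rho> A)) = Re (energy \<rho> A A)"
  using Kop_energy(2)[OF states_posD(1,2)[OF assms(1)] tangentD(1)[OF assms(2)] tangentD(1)[OF assms(2)]]
    tangentD(2)[OF assms(2)] by simp

lemma energy_nonneg:
  assumes "\<rho> \<in> states_pos S" "A \<in> Alg S"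
  shows "0 \<le> Re (energy \<rho> A A)"
proof -
  obtain m where m: "0 < m" "\<And>x. x \<in> spec \<rho> \<Longrightarrow> m \<le> x"
    using spec_lower_bound states_posD(3)[OF assms(1)] by blast
  have "0 \<le> log_mean \<mu> \<nu>" if "\<mu> \<in> spec \<rho>" "\<nu> \<in> spec \<rho>" for \<mu> \<nu>
    using log_mean_ge_min[of m \<mu> \<nu>] m that by force
  then show ?thesis using assms
    by (auto simp: energy_def intro!: sum_nonneg mult_nonneg_nonneg grad_form_sproj_nonneg)
qed

text \<open>Since the logarithmic mean dominates the minimum, the energy dominates a multiple of the
  Dirichlet form, whose only null directions are the scalars.\<close>

lemma Kop_injective:
  assumes \<rho>: "\<rho> \<in> states_pos S" and A: "A \<in> tangent S" and K: "Kop S \<rho> A = 0"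
  shows "A = 0"
proof -
  obtain m where m: "0 < m" "\<And>x. x \<in> spec \<rho> \<Longrightarrow> m \<le> x"
    using spec_lower_bound states_posD(3)[OF \<rho>] by blast
  have "m * (\<gamma> * Re (tr S (A\<^sup>\<star> ** A))) = m * Re (\<Sum>j\<in>Idx S. trB S j ((pd S j A)\<^sup>\<star> ** pd S j A))"
    using dirichlet_form[of A A] tangentD[OF A] by simp
  also have "\<dots> = m * Re (\<Sum>j\<in>Idx S. \<Sum>\<mu>\<in>spec \<rho>. \<Sum>\<nu>\<in>spec \<rho>. grad_form j (sproj \<rho> \<mu>) (sproj \<rho> \<nu>) A A)"
    using states_posD[OF \<rho>] tangentD(1)[OF A] by (simp add: sum_grad_form_sproj)
  also have "\<dots> = (\<Sum>j\<in>Idx S. \<Sum>\<mu>\<in>spec \<rho>. \<Sum>\<nu>\<in>spec \<rho>. m * Re (grad_form j (sproj \<rho> \<mu>) (sproj \<rho> \<nu>) A A))"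
    by (simp add: sum_distrib_left)
  also have "\<dots> \<le> (\<Sum>j\<in>Idx S. \<Sum>\<mu>\<in>spec \<rho>. \<Sum>\<nu>\<in>spec \<rho>.
      log_mean \<mu> \<nu> * Re (grad_form j (sproj \<rho> \<mu>) (sproj \<rho> \<nu>) A A))"
    using m \<rho> tangentD(1)[OF A]
    by (intro sum_mono mult_right_mono log_mean_ge_min grad_form_sproj_nonneg) auto
  also have "\<dots> = Re (tr S (A ** Kop S \<rho> A))"
    unfolding trace_Kop[OF \<rho> A] by (simp add: energy_def)
  finally have "Re (tr S (A\<^sup>\<star> ** A)) \<le> 0"
    using m(1) \<gamma>_pos by (simp add: K A.trace_0 mult_le_0_iff)
  then show ?thesis
    using A.trace_nonneg[of A] A.trace_eq_0[of A] tangentD(1)[OF A] by (simp add: complex_eq_iff)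
qed

lemma Kop_bij:
  assumes "\<rho> \<in> states_pos S"
  shows "bij_betw (Kop S \<rho>) (tangent S) (tangent S)"
proof (rule injective_endomorphism_surj[OF subspace_tangent])
  note \<rho> = states_posD(1,2)[OF assms]
  show "Kop S \<rho> (x + y) = Kop S \<rho> x + Kop S \<rho> y" if "x \<in> tangent S" "y \<in> tangent S" for x y
    using Kop_add[OF \<rho>] that tangentD(1) by blast
  show "Kop S \<rho> (r *\<^sub>R x) = r *\<^sub>R Kop S \<rho> x" if "x \<in> tangent S" for r x
    using Kop_scaleR[OF \<rho>] that tangentD(1) by blast
qed (use Kop_tangent states_posD(1,2)[OF assms] Kop_injective[OF assms] in blast)+

text \<open>Writing a tangent vector as \<open>Kop S \<rho> A\<close> removes the inverse from the
  metric; the later computations with \<open>metric_g\<close> go through such a potential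
  \<open>A\<close>.\<close>

lemma metric_Kop:
  assumes "\<rho> \<in> states_pos S" "A \<in> tangent S"
  shows "metric_g S \<rho> (Kop S \<rho> A) y = Re (tr S (A ** y))"
  using Kop_bij[OF assms(1)] assms(2) by (simp add: metric_g_def bij_betw_def inv_into_f_f)

lemma tangent_Kop_ex:
  assumes "\<rho> \<in> states_pos S" "x \<in> tangent S"
  obtains A where "A \<in> tangent S" "x = Kop S \<rho> A"
  using Kop_bij[OF assms(1)] assms(2) by (metis bij_betw_imp_surj_on imageE)

text \<open>A discrete chain rule: between the spectral projections of \<mu> and \<nu>,
  \<open>pd S j\<close> applied to f(\<rho>) is the scalar f(\<nu>) - f(\<mu>) times
  \<open>Vel S j\<close>.\<close>

lemma grad_form_fun_calc:
  assumes \<rho>: "\<rho> \<in> Alg S" "\<rho>\<^sup>\<star> = \<rho>" and j: "j \<in> Idx S" and B: "B \<in> Alg S"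
  shows "grad_form j (sproj \<rho> \<mu>) (sproj \<rho> \<nu>) B (fun_calc f \<rho>) = of_real (f \<nu> - f \<mu>) *
    trB S j ((pd S j B)\<^sup>\<star> ** (lhom S j (sproj \<rho> \<mu>) ** Vel S j ** rhom S j (sproj \<rho> \<nu>)))"
proof -
  interpret B: tracial_algebra "BAlg S j" "trB S j" using BAlg[OF j] .
  let ?F = "fun_calc f \<rho>" and ?P = "sproj \<rho>" and ?l = "lhom S j" and ?r = "rhom S j"
  have FP: "?F \<in> Alg S" "?P \<kappa> \<in> Alg S" for \<kappa>
    using \<rho> by (simp_all add: fun_calc_in_algebra sproj_in_algebra A.vN)
  have "?l (?P \<mu>) ** pd S j ?F ** ?r (?P \<nu>) =
      ?l (?P \<mu>) ** Vel S j ** ?r (?F ** ?P \<nu>) - ?l (?P \<mu> ** ?F) ** Vel S j ** ?r (?P \<nu>)"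
    by (simp add: pd_def cmat_mult_distribs matrix_mul_assoc FP unital_star_hom_dest(4)[OF lhom[OF j]]
        unital_star_hom_dest(4)[OF rhom[OF j]])
  also have "\<dots> = (f \<nu> - f \<mu>) *\<^sub>R (?l (?P \<mu>) ** Vel S j ** ?r (?P \<nu>))"
    by (simp add: fun_calc_sproj[OF \<rho>(2)] FP unital_star_hom_dest(5)[OF lhom[OF j]]
        unital_star_hom_dest(5)[OF rhom[OF j]] cmat_mult_scaleR scaleR_diff_left)
  finally show ?thesis
    using j B FP unital_star_hom_dest(1)[OF lhom[OF j]] unital_star_hom_dest(1)[OF rhom[OF j]]
    by (simp add: grad_form_def cmat_mult_scaleR B.trace_scaleR B.mem pd_mem Vel(1))
qed

text \<open>The differences of logarithms produced by \<open>pd\<close> cancel the denominators of the logarithmic mean,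
  leaving the Dirichlet form.\<close>

lemma Kop_ln:
  assumes \<rho>: "\<rho> \<in> states_pos S"
  shows "Kop S \<rho> (fun_calc ln \<rho>) = \<gamma> *\<^sub>R (\<rho> - mat 1)"
proof -
  note \<rho>' = states_posD[OF \<rho>]
  have ln: "fun_calc ln \<rho> \<in> Alg S" using \<rho>' by (simp add: fun_calc_in_algebra A.vN)
  note K = Kop_energy[OF \<rho>'(1,2) ln]
  show ?thesis
  proof (rule A.eq_by_trace)
    fix B assume B: "B \<in> Alg S"
    have "energy \<rho> B (fun_calc ln \<rho>) =
        (\<Sum>j\<in>Idx S. \<Sum>\<mu>\<in>spec \<rho>. \<Sum>\<nu>\<in>spec \<rho>. grad_form j (sproj \<rho> \<mu>) (sproj \<rho> \<nu>) B \<rho>)"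
      unfolding energy_def
    proof (intro sum.cong refl)
      fix j \<mu> \<nu> assume j: "j \<in> Idx S" and \<mu>\<nu>: "\<mu> \<in> spec \<rho>" "\<nu> \<in> spec \<rho>"
      have "log_mean \<mu> \<nu> * (ln \<nu> - ln \<mu>) = \<nu> - \<mu>"
        using \<mu>\<nu> pos_def_spec[OF \<rho>'(3)] by (intro log_mean_mult_ln_diff)
      then show "of_real (log_mean \<mu> \<nu>) * grad_form j (sproj \<rho> \<mu>) (sproj \<rho> \<nu>) B (fun_calc ln \<rho>) =
          grad_form j (sproj \<rho> \<mu>) (sproj \<rho> \<nu>) B \<rho>"
        using grad_form_fun_calc[OF \<rho>'(1,2) j B, of \<mu> \<nu> "\<lambda>x. x"] grad_form_fun_calc[OF \<rho>'(1,2) j B, of \<mu> \<nu> ln]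
        by (simp add: fun_calc_ident[OF \<rho>'(2)] mult.assoc[symmetric] of_real_mult[symmetric] del: of_real_mult of_real_diff)
    qed
    also have "\<dots> = (\<Sum>j\<in>Idx S. trB S j ((pd S j B)\<^sup>\<star> ** pd S j \<rho>))"
      by (intro sum.cong refl sum_grad_form_sproj \<rho>' B)
    also have "\<dots> = tr S (B\<^sup>\<star> ** \<gamma> *\<^sub>R (\<rho> - mat 1))"
      using B \<rho>' by (simp add: dirichlet_form cmat_mult_scaleR cmat_mult_distribs A.trace_scaleR A.trace_diff A.mem)
    finally show "tr S (B\<^sup>\<star> ** Kop S \<rho> (fun_calc ln \<rho>)) = tr S (B\<^sup>\<star> ** \<gamma> *\<^sub>R (\<rho> - mat 1))"
      using K(2)[OF B] by simp
  qed (use K(1) \<rho>'(1) in \<open>simp_all add: A.mem\<close>)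
qed

lemma Kop_mat_1:
  assumes \<rho>: "\<rho> \<in> states_pos S"
  shows "Kop S \<rho> (mat 1) = 0"
  using states_posD(1,2)[OF \<rho>]
  by (intro A.trace_nondegenerate)
    (simp_all add: Kop_energy A.mem energy_def grad_form_def pd_mat_1 tracial_algebra.trace_0[OF BAlg])

text \<open>The logarithm need not have trace 0, so it is replaced by its traceless part
  \<open>Z\<close>, which has the same pairing with \<open>v\<close> and the same image under
  \<open>Kop S \<rho>\<close>. Symmetry of that operator then moves it from the potential of
  \<open>v\<close> onto \<open>Z\<close>.\<close>

lemma trace_ln_eq_metric:
  assumes \<rho>: "\<rho> \<in> states_pos S" and v: "v \<in> tangent S"
  shows "Re (tr S (v ** fun_calc ln \<rho>)) = \<gamma> * metric_g S \<rho> v (\<rho> - mat 1)"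
proof -
  note \<rho>' = states_posD[OF \<rho>]
  define F where "F = fun_calc ln \<rho>"
  have F: "F \<in> Alg S" "F\<^sup>\<star> = F"
    using \<rho>' by (simp_all add: F_def fun_calc_in_algebra A.vN adj_fun_calc)
  define r where "r = Re (tr S F)"
  define Z where "Z = F - r *\<^sub>R mat 1"
  have "tr S F = of_real r"
    using A.trace_selfadjoint_real[OF F] by (simp add: r_def complex_eq_iff)
  then have Z: "Z \<in> tangent S"
    using F by (simp add: Z_def tangent_def A.mem adj_diff adj_scaleR A.trace_diff A.trace_scaleR trace_1)
  have KZ: "Kop S \<rho> Z = \<gamma> *\<^sub>R (\<rho> - mat 1)"
  proof -
    have "Kop S \<rho> (Z + r *\<^sub>R mat 1) = Kop S \<rho> Z + r *\<^sub>R Kop S \<rho> (mat 1)"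
      using \<rho>' tangentD(1)[OF Z] by (simp add: Kop_add Kop_scaleR A.mem)
    then show ?thesis using Kop_ln[OF \<rho>] by (simp add: Z_def Kop_mat_1[OF \<rho>] F_def)
  qed
  obtain A where A: "A \<in> tangent S" "v = Kop S \<rho> A" using tangent_Kop_ex[OF \<rho> v] by blast
  note v' = tangentD[OF v] and A' = tangentD[OF A(1)] and Z' = tangentD[OF Z]
  have "F = Z + r *\<^sub>R mat 1" by (simp add: Z_def)
  then have "tr S (v ** F) = tr S (v ** Z)"
    using v' Z' by (simp add: cmat_mult_distribs cmat_mult_scaleR A.trace_add A.trace_scaleR A.mem)
  also have "\<dots> = tr S (Z ** Kop S \<rho> A)"
    using A.trace_comm[of v Z] v' Z' A by simp
  finally have "Re (tr S (v ** F)) = Re (tr S (A ** Kop S \<rho> Z))"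
    using Kop_symmetric[OF \<rho>'(1,2) A(1) Z] by simp
  also have "\<dots> = \<gamma> * Re (tr S (A ** (\<rho> - mat 1)))"
    using A' \<rho>' by (simp add: KZ cmat_mult_scaleR A.trace_scaleR A.mem)
  finally show ?thesis using A \<rho> by (simp add: metric_Kop F_def)
qed

lemma Ent_eq: "\<rho> \<in> Alg S \<Longrightarrow> Ent S \<rho> = Re (tr S (\<rho> ** fun_calc ln \<rho>))"
  by (simp add: Ent_def sig_1 fun_calc_mat_1)

section \<open>Moving states away from the identity\<close>

lemma state_diff_tangent:
  assumes "\<rho> \<in> states_pos S" "\<rho>' \<in> states_pos S"
  shows "\<rho> - \<rho>' \<in> tangent S"
  using states_posD[OF assms(1)] states_posD[OF assms(2)]
  by (simp add: tangent_def A.mem adj_diff A.trace_diff)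

lemma state_minus_1_tangent:
  assumes "\<rho> \<in> states_pos S"
  shows "\<rho> - mat 1 \<in> tangent S"
  using states_posD[OF assms] by (simp add: tangent_def A.mem adj_diff A.trace_diff trace_1)

text \<open>The perturbed state keeps the spectral projections of \<rho>, so only the logarithmic
  means change. The bound \<open>t < m\<close> keeps its eigenvalues
  \<open>(1 + t) * \<mu> - t\<close> positive.\<close>

lemma state_affine:
  assumes \<rho>: "\<rho> \<in> states_pos S" and m: "\<And>x. x \<in> spec \<rho> \<Longrightarrow> m \<le> x" and t: "0 \<le> t" "t < m"
  shows "\<rho> + t *\<^sub>R (\<rho> - mat 1) \<in> states_pos S"
    and "A \<in> Alg S \<Longrightarrow> Re (energy (\<rho> + t *\<^sub>R (\<rho> - mat 1)) A A) \<le> (1 + t) * Re (energy \<rho> A A)"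
proof -
  note \<rho>' = states_posD[OF \<rho>]
  define \<rho>t where "\<rho>t = (1 + t) *\<^sub>R \<rho> + (- t) *\<^sub>R mat 1"
  have eq: "\<rho> + t *\<^sub>R (\<rho> - mat 1) = \<rho>t" by (simp add: \<rho>t_def algebra_simps)
  define f where "f \<mu> = (1 + t) * \<mu> - t" for \<mu> :: real
  have spec: "spec \<rho>t = f ` spec \<rho>"
    using spec_affine[of "1 + t" \<rho> "- t"] t by (simp add: \<rho>t_def f_def[abs_def])
  have P: "sproj \<rho>t (f \<mu>) = sproj \<rho> \<mu>" for \<mu>
    using sproj_affine[of "1 + t" \<rho> "- t" \<mu>] t by (simp add: \<rho>t_def f_def)
  have inj: "inj_on f (spec \<rho>)" using t by (auto simp: inj_on_def f_def)
  have pos: "0 < f \<mu>" if "\<mu> \<in> spec \<rho>" for \<mu>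
  proof -
    have "0 \<le> t * \<mu>" using m[OF that] t by simp
    then have "t < \<mu> + t * \<mu>" using m[OF that] t by linarith
    then show ?thesis by (simp add: f_def algebra_simps)
  qed
  have adj: "\<rho>t\<^sup>\<star> = \<rho>t" using \<rho>' by (simp add: \<rho>t_def adj_diff adj_scaleR)
  have "pos_def \<rho>t" by (rule pos_defI_spec[OF adj]) (auto simp: spec pos)
  moreover have "tr S \<rho>t = 1"
    using \<rho>' by (simp add: eq[symmetric] A.trace_add A.trace_scaleR A.trace_diff A.mem trace_1)
  ultimately show "\<rho> + t *\<^sub>R (\<rho> - mat 1) \<in> states_pos S"
    using \<rho>' unfolding eq by (simp add: states_pos_def) (simp add: \<rho>t_def A.mem)
  assume A: "A \<in> Alg S"
  have "Re (energy \<rho>t A A) = (\<Sum>j\<in>Idx S. \<Sum>\<mu>\<in>spec \<rho>. \<Sum>\<nu>\<in>spec \<rho>.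
      log_mean (f \<mu>) (f \<nu>) * Re (grad_form j (sproj \<rho> \<mu>) (sproj \<rho> \<nu>) A A))"
    by (simp add: energy_def spec sum.reindex[OF inj] P)
  also have "\<dots> \<le> (\<Sum>j\<in>Idx S. \<Sum>\<mu>\<in>spec \<rho>. \<Sum>\<nu>\<in>spec \<rho>.
      ((1 + t) * log_mean \<mu> \<nu>) * Re (grad_form j (sproj \<rho> \<mu>) (sproj \<rho> \<nu>) A A))"
    using \<rho> A pos_def_spec[OF \<rho>'(3)] pos t unfolding f_def
    by (intro sum_mono mult_right_mono log_mean_affine_le grad_form_sproj_nonneg) auto
  also have "\<dots> = (1 + t) * Re (energy \<rho> A A)"
    by (simp add: energy_def sum_distrib_left mult.assoc)
  finally show "Re (energy (\<rho> + t *\<^sub>R (\<rho> - mat 1)) A A) \<le> (1 + t) * Re (energy \<rho> A A)"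
    by (simp only: eq)
qed

text \<open>The metric is dual to the energy: \<open>g(v, v) \<ge> 2 \<tau>[A v] - \<tau>[A K A]\<close> for every \<open>A\<close>.
  Thus an upper bound on the energy is a lower bound on the metric.\<close>

lemma metric_affine_ge:
  assumes \<rho>: "\<rho> \<in> states_pos S" and m: "\<And>x. x \<in> spec \<rho> \<Longrightarrow> m \<le> x" and t: "0 \<le> t" "t < m"
    and v: "v \<in> tangent S"
  shows "(1 - t) * metric_g S \<rho> v v \<le> metric_g S (\<rho> + t *\<^sub>R (\<rho> - mat 1)) v v"
proof -
  define \<rho>t where "\<rho>t = \<rho> + t *\<^sub>R (\<rho> - mat 1)"
  have \<rho>t: "\<rho>t \<in> states_pos S" unfolding \<rho>t_def by (rule state_affine(1)[OF \<rho> m t])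
  \<comment> \<open>\<open>A\<close> is the potential of \<open>v\<close> at the original state,
    used below as a test element at the perturbed one, where the true potential is
    \<open>B\<close>.\<close>
  obtain A where A: "A \<in> tangent S" "v = Kop S \<rho> A" using tangent_Kop_ex[OF \<rho> v] by blast
  obtain B where B: "B \<in> tangent S" "v = Kop S \<rho>t B" using tangent_Kop_ex[OF \<rho>t v] by blast
  have BA: "B - A \<in> tangent S" using subspace_tangent A B by (simp add: subspace_diff)
  note A' = tangentD[OF A(1)] and B' = tangentD[OF B(1)] and r = states_posD(1,2)[OF \<rho>t]
  have K: "Kop S \<rho>t X \<in> Alg S" if "X \<in> Alg S" for X using Kop_energy(1)[OF r that] .
  have diff: "Kop S \<rho>t (B - A) = v - Kop S \<rho>t A"
    using Kop_add[OF r, of B "- 1 *\<^sub>R A"] Kop_scaleR[OF r, of A "- 1"] A' B' B(2) A.mem(6)[of A "- 1"] by simp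
  \<comment> \<open>Completing the square yields the dual inequality at the perturbed state. With
    \<open>\<tau>[A v] = g(v, v)\<close> at \<rho> and the energy bound, its right side is at least
    (2 - (1 + t)) g(v, v), whence the factor 1 - t.\<close>
  have "0 \<le> Re (tr S ((B - A) ** Kop S \<rho>t (B - A)))"
    using trace_Kop[OF \<rho>t BA] energy_nonneg[OF \<rho>t tangentD(1)[OF BA]] by simp
  also have "\<dots> = Re (tr S (B ** v)) - Re (tr S (B ** Kop S \<rho>t A)) - Re (tr S (A ** v)) + Re (tr S (A ** Kop S \<rho>t A))"
    using A' B' tangentD(1)[OF v] K by (simp add: diff cmat_mult_distribs A.trace_diff A.mem)
  also have "Re (tr S (B ** Kop S \<rho>t A)) = Re (tr S (A ** v))"
    using Kop_symmetric[OF r B(1) A(1)] B(2) by simp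
  also have "Re (tr S (B ** v)) = metric_g S \<rho>t v v"
    using metric_Kop[OF \<rho>t B(1), of v] B(2) by simp
  also have "Re (tr S (A ** v)) = metric_g S \<rho> v v"
    using metric_Kop[OF \<rho> A(1), of v] A(2) by simp
  also have "Re (tr S (A ** Kop S \<rho>t A)) \<le> (1 + t) * metric_g S \<rho> v v"
  proof -
    have "Re (tr S (A ** Kop S \<rho>t A)) \<le> (1 + t) * Re (tr S (A ** Kop S \<rho> A))"
      unfolding trace_Kop[OF \<rho>t A(1)] trace_Kop[OF \<rho> A(1)] unfolding \<rho>t_def
      by (rule state_affine(2)[OF \<rho> m t A'(1)])
    then show ?thesis using metric_Kop[OF \<rho> A(1), of v] A(2) by simp
  qed
  finally show ?thesis by (simp add: \<rho>t_def algebra_simps)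
qed

text \<open>The two-sided derivative is given, so its value is the right limit of the quotients, and
  for small t > 0 these are bounded below by \<open>metric_affine_ge\<close>.\<close>

lemma metric_derivative_ge:
  assumes \<rho>: "\<rho> \<in> states_pos S" and v: "v \<in> tangent S"
    and d: "((\<lambda>t. metric_g S (\<rho> + t *\<^sub>R (\<rho> - mat 1)) v v) has_real_derivative d) (at 0)"
  shows "- metric_g S \<rho> v v \<le> d"
proof -
  obtain m where m: "0 < m" "\<And>x. x \<in> spec \<rho> \<Longrightarrow> m \<le> x"
    using spec_lower_bound states_posD(3)[OF \<rho>] by blast
  let ?G = "\<lambda>t. metric_g S (\<rho> + t *\<^sub>R (\<rho> - mat 1)) v v"
  have "((\<lambda>t. (?G t - ?G 0) / (t - 0)) \<longlongrightarrow> d) (at 0)"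
    using d unfolding has_field_derivative_iff .
  then have "((\<lambda>t. (?G t - ?G 0) / (t - 0)) \<longlongrightarrow> d) (at_right 0)"
    by (rule tendsto_mono[OF at_le[OF subset_UNIV]])
  moreover have "\<forall>\<^sub>F t in at_right 0. - metric_g S \<rho> v v \<le> (?G t - ?G 0) / (t - 0)"
    using eventually_at_right_real[OF m(1)]
  proof eventually_elim
    case (elim t)
    then have "(1 - t) * metric_g S \<rho> v v \<le> ?G t"
      by (intro metric_affine_ge[OF \<rho> m(2)] v) auto
    then show ?case using elim by (simp add: field_simps)
  qed
  ultimately show ?thesis by (rule tendsto_lowerbound) simp
qed

section \<open>The second derivative of the entropy along a geodesic\<close>

lemma metric_sum:
  assumes \<rho>: "\<rho> \<in> states_pos S" and v: "v \<in> tangent S" and x: "x \<in> Alg S" and y: "\<And>i. i \<in> I \<Longrightarrow> y i \<in> Alg S"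
  shows "metric_g S \<rho> v (x + (\<Sum>i\<in>I. r i *\<^sub>R y i)) = metric_g S \<rho> v x + (\<Sum>i\<in>I. r i * metric_g S \<rho> v (y i))"
proof -
  obtain A where A: "A \<in> tangent S" "v = Kop S \<rho> A" using tangent_Kop_ex[OF \<rho> v] by blast
  show ?thesis
    using A tangentD(1)[OF A(1)] x y \<rho>
    by (simp add: metric_Kop cmat_mult_distribs cmat_mult_sum cmat_mult_scaleR A.trace_add A.trace_sum A.trace_scaleR A.mem)
qed

lemma Ent_hessian_bound:
  assumes geo: "riem_geodesic S {-\<epsilon><..<\<epsilon>} c c'" and \<epsilon>: "0 < \<epsilon>"
    and A: "A \<in> tangent S" and cA: "c' 0 = Kop S (c 0) A"
  shows "\<exists>h. has_second_derivative_at (\<lambda>s. Ent S (c s)) h 0 \<and>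
    \<gamma> / 2 * Re (tr S (A ** Kop S (c 0) A)) \<le> h"
proof -
  let ?I = "{-\<epsilon><..<\<epsilon>}"
  have I0: "0 \<in> ?I" using \<epsilon> by simp
  have c: "c s \<in> states_pos S" "(c has_vector_derivative c' s) (at s)" if "s \<in> ?I" for s
    using geo that unfolding riem_geodesic_def by blast+
  have near: "\<forall>\<^sub>F u in nhds s. u \<in> ?I" if "s \<in> ?I" for s
    using that by (intro eventually_nhds_in_open) auto
  have c': "c' s \<in> tangent S" if s: "s \<in> ?I" for s
  proof (rule vector_derivative_in_subspace[OF subspace_tangent c(2)[OF s]])
    show "\<forall>\<^sub>F u in nhds s. c u - c s \<in> tangent S"
      using near[OF s] by eventually_elim (intro state_diff_tangent c s)
  qed
  define \<phi> where "\<phi> u = metric_g S (c u) (c' u) (c u - mat 1)" for u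
  have dEnt: "((\<lambda>s. Ent S (c s)) has_real_derivative \<gamma> * \<phi> s) (at s)" if s: "s \<in> ?I" for s
  proof -
    have "((\<lambda>u. Re (tr S (c u ** fun_calc ln (c u)))) has_real_derivative
        Re (tr S (c' s ** fun_calc ln (c s)))) (at s)"
    proof (rule A.has_derivative_trace_ln[OF c(2)[OF s] tangentD(1)[OF c'[OF s]]])
      show "\<forall>\<^sub>F u in nhds s. c u \<in> Alg S \<and> pos_def (c u) \<and> tr S (c u) = 1"
        using near[OF s] by eventually_elim (simp add: states_posD[OF c(1)])
    qed
    moreover have "\<forall>\<^sub>F u in nhds s. Re (tr S (c u ** fun_calc ln (c u))) = Ent S (c u)"
      using near[OF s] by eventually_elim (simp add: Ent_eq states_posD[OF c(1)])
    ultimately show ?thesis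
      unfolding \<phi>_def trace_ln_eq_metric[OF c(1)[OF s] c'[OF s], symmetric]
      by (rule DERIV_cong_ev[OF refl _ refl, THEN iffD1, rotated])
  qed
  define \<rho> where "\<rho> = c 0"
  have \<rho>: "\<rho> \<in> states_pos S" unfolding \<rho>_def by (rule c(1)[OF I0])
  have \<rho>1: "\<rho> - mat 1 \<in> tangent S" by (rule state_minus_1_tangent[OF \<rho>])
  have deriv: "\<exists>d. ((\<lambda>t. metric_g S (\<rho> + t *\<^sub>R x) (c' 0) (c' 0)) has_real_derivative d) (at 0) \<and>
      ((\<lambda>u. metric_g S (c u) (c' u) x) has_real_derivative d / 2) (at 0)" if "x \<in> tangent S" for x
    using geo I0 that unfolding riem_geodesic_def \<rho>_def by blast
  obtain d where d: "((\<lambda>t. metric_g S (\<rho> + t *\<^sub>R (\<rho> - mat 1)) (c' 0) (c' 0)) has_real_derivative d) (at 0)"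
    and d2: "((\<lambda>u. metric_g S (c u) (c' u) (\<rho> - mat 1)) has_real_derivative d / 2) (at 0)"
    using deriv[OF \<rho>1] by blast
  \<comment> \<open>The geodesic equation differentiates \<open>metric_g S (c u) (c' u) x\<close>
    only for fixed \<open>x\<close>, whereas \<phi> contains \<open>c u - mat 1\<close>. Writing
    this as \<open>\<rho> - mat 1\<close> plus a basis expansion of \<open>c u - \<rho>\<close>
    leaves only fixed tangent vectors.\<close>
  obtain B where B: "B \<subseteq> tangent S" "pairwise orthogonal B" "\<And>x. x \<in> B \<Longrightarrow> norm x = 1"
    "independent B" "span B = tangent S"
    using orthonormal_basis_subspace[OF subspace_tangent] by metis
  have fin: "finite B" using B(4) by (rule independent_imp_finite)
  have expand: "(\<Sum>e\<in>B. (x \<bullet> e) *\<^sub>R e) = x" if "x \<in> tangent S" for x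
    using B that fin by (intro orthonormal_basis_expand) auto
  have B_alg: "e \<in> Alg S" if "e \<in> B" for e using B(1) that tangentD(1) by blast
  have "\<forall>e\<in>B. \<exists>d. ((\<lambda>u. metric_g S (c u) (c' u) e) has_real_derivative d) (at 0)"
    using deriv B(1) by blast
  then obtain D where D: "\<And>e. e \<in> B \<Longrightarrow> ((\<lambda>u. metric_g S (c u) (c' u) e) has_real_derivative D e) (at 0)"
    using bchoice[of B "\<lambda>e d. ((\<lambda>u. metric_g S (c u) (c' u) e) has_real_derivative d) (at 0)"] by blast
  \<comment> \<open>The coefficients \<open>(c u - \<rho>) \<bullet> e\<close> vanish at u = 0, so
    the unknown derivatives \<open>D e\<close> drop out of the product rule; what remains sums to
    g(c', c').\<close>
  have deriv_expansion: "((\<lambda>u. metric_g S (c u) (c' u) (\<rho> - mat 1) + (\<Sum>e\<in>B. ((c u - \<rho>) \<bullet> e) * metric_g S (c u) (c' u) e))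
      has_real_derivative d / 2 + (\<Sum>e\<in>B. (c' 0 \<bullet> e) * metric_g S \<rho> (c' 0) e)) (at 0)"
  proof (intro DERIV_add d2 DERIV_sum)
    fix e assume e: "e \<in> B"
    have "((\<lambda>u. (c u - \<rho>) \<bullet> e) has_real_derivative c' 0 \<bullet> e) (at 0)"
      using bounded_linear.has_vector_derivative[OF bounded_linear_inner_left
          has_vector_derivative_diff[OF c(2)[OF I0] has_vector_derivative_const[of \<rho>]], of e]
      by (simp add: has_real_derivative_iff_has_vector_derivative)
    from DERIV_mult[OF this D[OF e]]
    show "((\<lambda>u. ((c u - \<rho>) \<bullet> e) * metric_g S (c u) (c' u) e) has_real_derivative
        (c' 0 \<bullet> e) * metric_g S \<rho> (c' 0) e) (at 0)"
      by (simp add: \<rho>_def)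
  qed
  have at_0: "(\<Sum>e\<in>B. (c' 0 \<bullet> e) * metric_g S \<rho> (c' 0) e) = metric_g S \<rho> (c' 0) (c' 0)"
  proof -
    have "metric_g S \<rho> (c' 0) 0 = 0"
      using metric_Kop[OF \<rho> A] by (simp add: cA \<rho>_def A.trace_0)
    then show ?thesis
      using metric_sum[OF \<rho> c'[OF I0] A.mem(8) B_alg, of B "\<lambda>e. e" "\<lambda>e. c' 0 \<bullet> e"] expand[OF c'[OF I0]] by simp
  qed
  have expansion: "\<forall>\<^sub>F u in nhds 0. metric_g S (c u) (c' u) (\<rho> - mat 1) +
      (\<Sum>e\<in>B. ((c u - \<rho>) \<bullet> e) * metric_g S (c u) (c' u) e) = \<phi> u"
    using near[OF I0]
  proof eventually_elim
    case (elim u)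
    have eq: "c u - mat 1 = (\<rho> - mat 1) + (\<Sum>e\<in>B. ((c u - \<rho>) \<bullet> e) *\<^sub>R e)"
      using expand[OF state_diff_tangent[OF c(1)[OF elim] \<rho>]] by simp
    show ?case
      using metric_sum[OF c(1)[OF elim] c'[OF elim] tangentD(1)[OF \<rho>1] B_alg,
          of B "\<lambda>e. e" "\<lambda>e. (c u - \<rho>) \<bullet> e"]
      unfolding eq[symmetric] \<phi>_def by simp
  qed
  have d\<phi>: "(\<phi> has_real_derivative d / 2 + metric_g S \<rho> (c' 0) (c' 0)) (at 0)"
    using DERIV_cong_ev[OF refl expansion refl, THEN iffD1, OF deriv_expansion] unfolding at_0 .
  let ?h = "\<gamma> * (d / 2 + metric_g S \<rho> (c' 0) (c' 0))"
  have "has_second_derivative_at (\<lambda>s. Ent S (c s)) ?h 0"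
    unfolding has_second_derivative_at_def
  proof (intro exI conjI)
    show "\<forall>\<^sub>F u in nhds 0. ((\<lambda>s. Ent S (c s)) has_real_derivative \<gamma> * \<phi> u) (at u)"
      using near[OF I0] by eventually_elim (rule dEnt)
    show "((\<lambda>u. \<gamma> * \<phi> u) has_real_derivative ?h) (at 0)" by (rule DERIV_cmult[OF d\<phi>])
  qed
  moreover have "\<gamma> / 2 * Re (tr S (A ** Kop S (c 0) A)) \<le> ?h"
  proof -
    \<comment> \<open>The initial velocity has potential \<open>A\<close>, so the quantity in the
      Ricci bound is its squared length.\<close>
    have "Re (tr S (A ** Kop S (c 0) A)) = metric_g S \<rho> (c' 0) (c' 0)"
      using metric_Kop[OF \<rho> A] by (simp add: cA \<rho>_def)
    moreover have "- metric_g S \<rho> (c' 0) (c' 0) \<le> d"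
      by (rule metric_derivative_ge[OF \<rho> c'[OF I0] d])
    ultimately have "Re (tr S (A ** Kop S (c 0) A)) / 2 \<le> d / 2 + metric_g S \<rho> (c' 0) (c' 0)" by simp
    from mult_left_mono[OF this less_imp_le[OF \<gamma>_pos]] show ?thesis by simp
  qed
  ultimately show ?thesis by blast
qed

end

theorem theorem10p6:
  fixes S :: "('n::finite, 'm::finite, 'j) diff_data"
    and L :: "'n cmat \<Rightarrow> 'n cmat"
    and \<gamma> :: real
  assumes "\<gamma> > 0"
    and "differential_structure S"
    and "tr S (mat 1) = 1"
    and "sig S = mat 1"
    and "is_generator S L"
    and "\<forall>A\<in>Alg S. L A = \<gamma> *\<^sub>R (tr S A *\<^sub>C mat 1 - A)"
  shows "Ric_ge S (\<gamma> / 2)"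
proof -
  interpret depolarizing_structure S L \<gamma> by standard (fact assms)+
  show ?thesis unfolding Ric_ge_def using Ent_hessian_bound by blast
qed

end
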